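(* Let $\mathbf{P}$ be a nondegenerate polar space of rank $d \ge 3$ in a vector space $V$ over $\mathbb{F}_q$, with collinearity graph $\Gamma_0$. Let $U$ be (the set of points of) a totally isotropic (maximal singular) $d$-space, let $\mathcal{H}$ be the set of hyperplanes of $U$, let $\mathbf{D}$ be a symmetric design on the point set $U$ with the parameters $2$-$\big(\frac{q^{d}-1}{q-1}, \frac{q^{d-1}-1}{q-1}, \frac{q^{d-2}-1}{q-1}\big)$, and let $\phi$ be a bijection from $\mathcal{H}$ to the set of blocks of $\mathbf{D}$. Then the graph $\Gamma_\phi$ is strongly regular with the same parameters as $\Gamma_0$.
   Context: The polar spaces considered are the finite nondegenerate polar spaces consisting of the totally isotropic (or totally singular) points and lines of a finite-dimensional vector space $V$ over $\mathbb{F}_q$ with respect to a nondegenerate symplectic, quadratic or hermitian form. Two points are collinear when they lie on a common totally isotropic/singular line; $x^\perp$ is the set of points collinear with $x$, including $x$ itself. A singular subspace is a line-closed set of pairwise collinear points; the rank $d$ is the vector space dimension of the maximal singular subspaces. The collinearity graph $\Gamma_0$ has the point set $P$ of $\mathbf{P}$ as vertices, distinct points being adjacent when collinear. Subspaces are identified with their sets of projective points, and "hyperplane of $U$" means $(d-1)$-dimensional subspace of $U$. For $y \in P\setminus U$ the set $y^\perp\cap U$ is a hyperplane of $U$. The image of $H$ under $\phi$ is written $H^\phi$, a block of $\mathbf{D}$, viewed as a subset of $U$. The graph $\Gamma_\phi$ has vertex set $P$, with adjacency as follows: (1) distinct vertices in $U$ are adjacent; (2) distinct vertices $x,y \notin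 U$ are adjacent if and only if $x \in y^\perp$; (3) vertices $x \in U$, $y \notin U$ are adjacent if and only if $x \in (y^\perp \cap U)^\phi$. A graph of order $v$ is strongly regular with parameters $(v,k,\lambda,\mu)$ if it is neither complete nor edgeless, each vertex has degree $k$, any two adjacent vertices have exactly $\lambda$ common neighbors, and any two distinct non-adjacent vertices have exactly $\mu$ common neighbors. *)

theory Defs
  imports Main "HOL.Vector_Spaces" "HOL-Library.Cardinality"
begin

definition strongly_regular ::
  "'p set \<Rightarrow> ('p \<Rightarrow> 'p \<Rightarrow> bool) \<Rightarrow> nat \<Rightarrow> nat \<Rightarrow> nat \<Rightarrow> nat \<Rightarrow> bool" where
  "strongly_regular P adj v k l m \<longleftrightarrow>
     finite P \<and> symp_on P adj \<and> irreflp_on P adj \<and>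
     card P = v \<and>
     (\<exists>x\<in>P. \<exists>y\<in>P. x \<noteq> y \<and> \<not> adj x y) \<and>
     (\<exists>x\<in>P. \<exists>y\<in>P. adj x y) \<and>
     (\<forall>x\<in>P. card {z \<in> P. adj x z} = k) \<and>
     (\<forall>x\<in>P. \<forall>y\<in>P. adj x y \<longrightarrow> card {z \<in> P. adj x z \<and> adj y z} = l) \<and>
     (\<forall>x\<in>P. \<forall>y\<in>P. x \<noteq> y \<and> \<not> adj x y \<longrightarrow> card {z \<in> P. adj x z \<and> adj y z} = m)"

text \<open>A symmetric \<open>2\<close>-\<open>(v, k, l)\<close> design, given by its set of blocks (as sets of points); symmetric
  means that there are as many blocks as points.\<close>

definition symmetric_design ::
  "'p set \<Rightarrow> 'p set set \<Rightarrow> nat \<Rightarrow> nat \<Rightarrow> nat \<Rightarrow> bool" where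
  "symmetric_design X \<B> v k l \<longleftrightarrow>
     finite X \<and> card X = v \<and>
     (\<forall>B\<in>\<B>. B \<subseteq> X \<and> card B = k) \<and>
     (\<forall>x\<in>X. \<forall>y\<in>X. x \<noteq> y \<longrightarrow> card {B \<in> \<B>. x \<in> B \<and> y \<in> B} = l) \<and>
     card \<B> = card X"

text \<open>The first argument of \<open>Hermitian\<close> is the field involution.\<close>

datatype ('k, 'v) form =
    Symplectic "'v \<Rightarrow> 'v \<Rightarrow> 'k"
  | Quadratic "'v \<Rightarrow> 'k"
  | Hermitian "'k \<Rightarrow> 'k" "'v \<Rightarrow> 'v \<Rightarrow> 'k"

definition field_involution :: "('k::field \<Rightarrow> 'k) \<Rightarrow> bool" where
  "field_involution \<sigma> \<longleftrightarrow>
     (\<forall>a b. \<sigma> (a + b) = \<sigma> a + \<sigma> b) \<and> (\<forall>a b. \<sigma> (a * b) = \<sigma> a * \<sigma> b) \<and>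
     (\<forall>a. \<sigma> (\<sigma> a) = a) \<and> \<sigma> \<noteq> id"

definition polar_form :: "('v::ab_group_add \<Rightarrow> 'k::field) \<Rightarrow> 'v \<Rightarrow> 'v \<Rightarrow> 'k" where
  "polar_form Q v w = Q (v + w) - Q v - Q w"

context vector_space
begin

definition bilinear_form :: "('b \<Rightarrow> 'b \<Rightarrow> 'a) \<Rightarrow> bool" where
  "bilinear_form f \<longleftrightarrow>
     (\<forall>v. Vector_Spaces.linear scale (*) (\<lambda>w. f v w)) \<and>
     (\<forall>w. Vector_Spaces.linear scale (*) (\<lambda>v. f v w))"

text \<open>A quadratic form is nondegenerate when it has no nonzero singular vector in the radical of its
  polar form. In characteristic 2 and odd dimension the radical itself is nonzero, so asking for
  a nondegenerate polar form would wrongly exclude the parabolic quadrics.\<close>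

fun nondegenerate_form :: "('a, 'b) form \<Rightarrow> bool" where
  "nondegenerate_form (Symplectic f) \<longleftrightarrow>
     bilinear_form f \<and> (\<forall>v. f v v = 0) \<and>
     (\<forall>v. (\<forall>w. f v w = 0) \<longrightarrow> v = 0)"
| "nondegenerate_form (Quadratic Q) \<longleftrightarrow>
     (\<forall>a v. Q (scale a v) = a\<^sup>2 * Q v) \<and> bilinear_form (polar_form Q) \<and>
     (\<forall>v. Q v = 0 \<and> (\<forall>w. polar_form Q v w = 0) \<longrightarrow> v = 0)"
| "nondegenerate_form (Hermitian \<sigma> h) \<longleftrightarrow>
     field_involution \<sigma> \<and>
     (\<forall>w. Vector_Spaces.linear scale (*) (\<lambda>v. h v w)) \<and>
     (\<forall>v w. h w v = \<sigma> (h v w)) \<and>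
     (\<forall>v. (\<forall>w. h v w = 0) \<longrightarrow> v = 0)"

text \<open>Totally isotropic (symplectic, hermitian) or totally singular (quadratic) subspaces of the
  vector space.\<close>

fun vanishes_on :: "('a, 'b) form \<Rightarrow> 'b set \<Rightarrow> bool" where
  "vanishes_on (Symplectic f) W \<longleftrightarrow> (\<forall>v\<in>W. \<forall>w\<in>W. f v w = 0)"
| "vanishes_on (Quadratic Q) W \<longleftrightarrow> (\<forall>v\<in>W. Q v = 0)"
| "vanishes_on (Hermitian \<sigma> h) W \<longleftrightarrow> (\<forall>v\<in>W. \<forall>w\<in>W. h v w = 0)"

definition totally_isotropic :: "('a, 'b) form \<Rightarrow> 'b set \<Rightarrow> bool" where
  "totally_isotropic F W \<longleftrightarrow> subspace W \<and> vanishes_on F W"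

text \<open>A projective point is a 1-dimensional subspace, itself a set of vectors.\<close>

definition proj_points :: "'b set \<Rightarrow> 'b set set" where
  "proj_points W = {p. subspace p \<and> dim p = 1 \<and> p \<subseteq> W}"

definition polar_points :: "('a, 'b) form \<Rightarrow> 'b set set" where
  "polar_points F = {p. totally_isotropic F p \<and> dim p = 1}"

definition polar_lines :: "('a, 'b) form \<Rightarrow> 'b set set" where
  "polar_lines F = {L. totally_isotropic F L \<and> dim L = 2}"

definition collinear_points :: "('a, 'b) form \<Rightarrow> 'b set \<Rightarrow> 'b set \<Rightarrow> bool" where
  "collinear_points F x y \<longleftrightarrow>
     x \<in> polar_points F \<and> y \<in> polar_points F \<and> (\<exists>L\<in>polar_lines F. x \<subseteq> L \<and> y \<subseteq> L)"

definition perp :: "('a, 'b) form \<Rightarrow> 'b set \<Rightarrow> 'b set set" where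
  "perp F x = insert x {y. collinear_points F x y}"

definition singular_subspace :: "('a, 'b) form \<Rightarrow> 'b set set \<Rightarrow> bool" where
  "singular_subspace F S \<longleftrightarrow>
     S \<subseteq> polar_points F \<and>
     (\<forall>x\<in>S. \<forall>y\<in>S. x \<noteq> y \<longrightarrow> collinear_points F x y) \<and>
     (\<forall>x\<in>S. \<forall>y\<in>S. \<forall>L\<in>polar_lines F. x \<noteq> y \<and> x \<subseteq> L \<and> y \<subseteq> L \<longrightarrow> proj_points L \<subseteq> S)"

definition maximal_singular_subspace :: "('a, 'b) form \<Rightarrow> 'b set set \<Rightarrow> bool" where
  "maximal_singular_subspace F S \<longleftrightarrow>
     singular_subspace F S \<and> (\<forall>T. singular_subspace F T \<and> S \<subseteq> T \<longrightarrow> T = S)"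

definition has_rank :: "('a, 'b) form \<Rightarrow> nat \<Rightarrow> bool" where
  "has_rank F d \<longleftrightarrow> (\<forall>S. maximal_singular_subspace F S \<longrightarrow> dim (span (\<Union>S)) = d)"

definition hyperplanes :: "'b set \<Rightarrow> 'b set set set" where
  "hyperplanes W = {proj_points H | H. subspace H \<and> H \<subseteq> W \<and> Suc (dim H) = dim W}"

definition collinearity_adj :: "('a, 'b) form \<Rightarrow> 'b set \<Rightarrow> 'b set \<Rightarrow> bool" where
  "collinearity_adj F x y \<longleftrightarrow> x \<noteq> y \<and> collinear_points F x y"

definition modified_adj ::
  "('a, 'b) form \<Rightarrow> 'b set set \<Rightarrow> ('b set set \<Rightarrow> 'b set set) \<Rightarrow> 'b set \<Rightarrow> 'b set \<Rightarrow> bool" where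
  "modified_adj F U \<phi> x y \<longleftrightarrow>
     (x \<in> U \<and> y \<in> U \<and> x \<noteq> y) \<or>
     (x \<notin> U \<and> y \<notin> U \<and> x \<noteq> y \<and> x \<in> perp F y) \<or>
     (x \<in> U \<and> y \<notin> U \<and> x \<in> \<phi> (perp F y \<inter> U)) \<or>
     (x \<notin> U \<and> y \<in> U \<and> y \<in> \<phi> (perp F x \<inter> U))"

end

end

theory Submission
  imports Defs
begin

text \<open>
  Let \<open>U\<close> be a generator with hyperplane set \<open>\<H>\<close>. A point \<open>y\<close> outside \<open>U\<close> enters the adjacency
  with \<open>U\<close> only through its trace \<open>H = y\<^sup>\<perp> \<inter> U\<close>. All degrees and numbers of common neighbours in
  \<open>\<Gamma>\<^sub>\<phi>\<close> are therefore determined by the number \<open>N\<close> of outer points with a given trace, the number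
  \<open>b\<close> of those adjacent to a fixed outer point with a different trace, the adjacency of the outer
  points among themselves, and the intersection numbers of the blocks \<open>\<phi> H\<close>; and the hyperplanes
  themselves form a symmetric design with the same intersection numbers. So \<open>\<Gamma>\<^sub>\<phi>\<close> has the same
  counts as \<open>\<Gamma>\<^sub>0\<close>, which is the case \<open>\<phi> = id\<close>.

  Strong regularity of \<open>\<Gamma>\<^sub>0\<close> comes from the same counts, applied to varying generators: any point
  and any two collinear points lie in a generator, so it suffices that \<open>N\<close> and \<open>b\<close> do not depend on
  \<open>U\<close>. This reduces to the number of singular vectors orthogonal to a \<open>(d - 1)\<close>-dimensional
  totally isotropic space being constant, which follows by translating singular vectors \<open>z\<close>
  orthogonal to \<open>a\<close> by multiples of \<open>a\<close>.
\<close>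

subsection \<open>Symmetric designs\<close>

text \<open>Double counting of the triples \<open>(x, x', y)\<close> with \<open>x\<close> and
  \<open>x'\<close> both incident with \<open>y\<close>: the pairs with \<open>x = x'\<close>
  contribute \<open>k\<close> each, all others \<open>l\<close>.\<close>

lemma sum_square_incidence:
  assumes "finite X" "finite Y"
    and "\<And>x. x \<in> X \<Longrightarrow> card {y \<in> Y. I x y} = k"
    and "\<And>x x'. x \<in> X \<Longrightarrow> x' \<in> X \<Longrightarrow> x \<noteq> x' \<Longrightarrow> card {y \<in> Y. I x y \<and> I x' y} = l"
  shows "(\<Sum>y\<in>Y. (card {x \<in> X. I x y})\<^sup>2) = card X * (k + (card X - 1) * l)"
proof -
  have sq: "card {p \<in> X \<times> X. I (fst p) y \<and> I (snd p) y} = (card {x \<in> X. I x y})\<^sup>2" for y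
  proof -
    have "{p \<in> X \<times> X. I (fst p) y \<and> I (snd p) y} = {x \<in> X. I x y} \<times> {x \<in> X. I x y}"
      by auto
    then show ?thesis
      by (simp add: card_cartesian_product power2_eq_square)
  qed
  have "(\<Sum>p\<in>X \<times> X. card {y \<in> Y. I (fst p) y \<and> I (snd p) y})
      = (\<Sum>y\<in>Y. (card {x \<in> X. I x y})\<^sup>2)"
    by (rule sum_multicount_gen) (use assms sq in auto)
  moreover have "(\<Sum>p\<in>X \<times> X. card {y \<in> Y. I (fst p) y \<and> I (snd p) y})
      = (\<Sum>x\<in>X. \<Sum>x'\<in>X. card {y \<in> Y. I x y \<and> I x' y})"
    by (simp add: sum.cartesian_product case_prod_beta)
  moreover have "(\<Sum>x'\<in>X. card {y \<in> Y. I x y \<and> I x' y}) = k + (card X - 1) * l"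
    if "x \<in> X" for x
  proof -
    have "(\<Sum>x'\<in>X - {x}. card {y \<in> Y. I x y \<and> I x' y}) = (\<Sum>x'\<in>X - {x}. l)"
      using that assms(4) by (intro sum.cong) auto
    then show ?thesis
      using that assms by (simp add: sum.remove[of X x])
  qed
  ultimately show ?thesis
    by simp
qed

text \<open>The assumption is the expanded sum of the squares of \<open>r y - c\<close>, taken over
  the integers, so every square is zero.\<close>

lemma constant_if_variance_0:
  fixes r :: "'a \<Rightarrow> nat"
  assumes "finite Y" "y \<in> Y"
    and "(\<Sum>y\<in>Y. (int (r y))\<^sup>2) - 2 * int c * (\<Sum>y\<in>Y. int (r y)) + int (card Y) * (int c)\<^sup>2 = 0"
  shows "r y = c"
proof -
  have "(\<Sum>y\<in>Y. (int (r y) - int c)\<^sup>2)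
      = (\<Sum>y\<in>Y. (int (r y))\<^sup>2) - 2 * int c * (\<Sum>y\<in>Y. int (r y)) + int (card Y) * (int c)\<^sup>2"
    by (simp add: power2_diff sum.distrib sum_subtractf sum_distrib_left algebra_simps)
  then have "(\<Sum>y\<in>Y. (int (r y) - int c)\<^sup>2) = 0"
    using assms by simp
  then show ?thesis
    using assms by (simp add: sum_nonneg_eq_0_iff)
qed

text \<open>The column sizes have mean \<open>k\<close> because there are as many columns as rows,
  and the design relation \<open>params\<close> makes their second moment \<open>k * k\<close> on
  average. Their variance about \<open>k\<close> is therefore zero.\<close>

lemma replication_of_pairs:
  assumes "finite X" "finite Y"
    and row: "\<And>x. x \<in> X \<Longrightarrow> card {y \<in> Y. I x y} = k"
    and pairs: "\<And>x x'. x \<in> X \<Longrightarrow> x' \<in> X \<Longrightarrow> x \<noteq> x' \<Longrightarrow> card {y \<in> Y. I x y \<and> I x' y} = l"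
    and card: "card X = v" "card Y = v" and params: "l * (v - 1) = k * (k - 1)"
    and "y \<in> Y"
  shows "card {x \<in> X. I x y} = k"
proof (rule constant_if_variance_0[where r = "\<lambda>y. card {x \<in> X. I x y}", OF \<open>finite Y\<close> \<open>y \<in> Y\<close>])
  have "(\<Sum>y\<in>Y. card {x \<in> X. I x y}) = v * k"
    using sum_multicount_gen[of X Y I "\<lambda>y. card {x \<in> X. I x y}"] assms by simp
  then have 1: "(\<Sum>y\<in>Y. int (card {x \<in> X. I x y})) = int v * int k"
    by (simp flip: of_nat_mult of_nat_sum)
  have "(\<Sum>y\<in>Y. (card {x \<in> X. I x y})\<^sup>2) = v * (k + (v - 1) * l)"
    using sum_square_incidence[OF assms(1-4)] card by simp
  \<comment> \<open>The case \<open>k = 0\<close> is separate because \<open>k - 1\<close> is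
    truncated; otherwise \<open>k + (v - 1) * l = k + k * (k - 1)\<close>.\<close>
  also have "\<dots> = v * (k * k)"
    using params by (cases k) (auto simp: mult.commute algebra_simps)
  finally have "int (\<Sum>y\<in>Y. (card {x \<in> X. I x y})\<^sup>2) = int (v * (k * k))"
    by simp
  then have "(\<Sum>y\<in>Y. (int (card {x \<in> X. I x y}))\<^sup>2) = int v * (int k * int k)"
    by simp
  with 1 show "(\<Sum>y\<in>Y. (int (card {x \<in> X. I x y}))\<^sup>2)
      - 2 * int k * (\<Sum>y\<in>Y. int (card {x \<in> X. I x y})) + int (card Y) * (int k)\<^sup>2 = 0"
    using card by (simp add: power2_eq_square algebra_simps)
qed

text \<open>The classical argument that blocks of a symmetric design meet in \<open>l\<close>
  points: for fixed \<open>y\<close>, the sizes \<open>m z\<close> of the intersections with the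
  \<open>v - 1\<close> other columns \<open>z\<close> have sum \<open>l * (v - 1)\<close> and sum of
  squares \<open>l * l * (v - 1)\<close>, so their variance about \<open>l\<close> is zero.\<close>

lemma dual_pairs:
  assumes "finite X" "finite Y"
    and row: "\<And>x. x \<in> X \<Longrightarrow> card {y \<in> Y. I x y} = k"
    and column: "\<And>y. y \<in> Y \<Longrightarrow> card {x \<in> X. I x y} = k"
    and pairs: "\<And>x x'. x \<in> X \<Longrightarrow> x' \<in> X \<Longrightarrow> x \<noteq> x' \<Longrightarrow> card {y \<in> Y. I x y \<and> I x' y} = l"
    and card: "card Y = v" and params: "l * (v - 1) = k * (k - 1)"
    and "y \<in> Y" "y' \<in> Y" "y \<noteq> y'"
  shows "card {x \<in> X. I x y \<and> I x y'} = l"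
proof -
  define B where "B = {x \<in> X. I x y}"
  define m where "m z = card {x \<in> B. I x z}" for z
  have B: "finite B" "B \<subseteq> X" "card B = k"
    using assms by (auto simp: B_def)
  have my: "m y = k"
    using B by (simp add: m_def B_def conj_commute cong: conj_cong)
  have "v \<ge> 1"
    using assms(2,8) card by (metis One_nat_def Suc_leI card_gt_0_iff empty_iff)
  have "(\<Sum>z\<in>Y. m z) = k * k"
    unfolding m_def
    using sum_multicount_gen[of B Y I "\<lambda>z. card {x \<in> B. I x z}"] B assms by (simp add: subset_iff)
  then have "k + (\<Sum>z\<in>Y - {y}. m z) = k * k"
    using my assms by (simp add: sum.remove)
  then have "int k + (\<Sum>z\<in>Y - {y}. int (m z)) = int k * int k"
    by (simp flip: of_nat_mult of_nat_sum of_nat_add)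
  then have 1: "(\<Sum>z\<in>Y - {y}. int (m z)) = int k * int k - int k"
    by linarith
  \<comment> \<open>The second moment comes from the incidence restricted to the \<open>k\<close>
    rows in \<open>B\<close>, which still has row size \<open>k\<close> and pair number
    \<open>l\<close>.\<close>
  have "(\<Sum>z\<in>Y. (m z)\<^sup>2) = k * (k + (k - 1) * l)"
    using sum_square_incidence[of B Y I k l] B assms by (simp add: m_def subset_iff)
  then have "(m y)\<^sup>2 + (\<Sum>z\<in>Y - {y}. (m z)\<^sup>2) = k * (k + (k - 1) * l)"
    using assms by (simp add: sum.remove)
  then have "(\<Sum>z\<in>Y - {y}. (m z)\<^sup>2) = k * (k - 1) * l"
    using my by (simp add: power2_eq_square algebra_simps)
  also have "\<dots> = l * (l * (v - 1))"
    using params by simp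
  finally have "int (\<Sum>z\<in>Y - {y}. (m z)\<^sup>2) = int (l * (l * (v - 1)))"
    by simp
  then have 2: "(\<Sum>z\<in>Y - {y}. (int (m z))\<^sup>2) = int l * (int l * (int v - 1))"
    using \<open>v \<ge> 1\<close> by (simp add: of_nat_diff)
  have params': "int l * (int v - 1) = int k * int k - int k"
  proof -
    have "int (l * (v - 1)) = int (k * (k - 1))"
      using params by simp
    then show ?thesis
      using \<open>v \<ge> 1\<close> by (cases k) (simp_all add: of_nat_diff algebra_simps)
  qed
  have "m y' = l"
  proof (rule constant_if_variance_0[where r = m])
    show "finite (Y - {y})" "y' \<in> Y - {y}"
      using assms by auto
    have 3: "int (card (Y - {y})) = int v - 1"
      using assms \<open>v \<ge> 1\<close> by (simp add: of_nat_diff)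
    show "(\<Sum>y\<in>Y - {y}. (int (m y))\<^sup>2) - 2 * int l * (\<Sum>y\<in>Y - {y}. int (m y))
        + int (card (Y - {y})) * (int l)\<^sup>2 = 0"
      unfolding 1 2 3 params'[symmetric] by (simp add: power2_eq_square algebra_simps)
  qed
  then show ?thesis
    by (simp add: m_def B_def)
qed

text \<open>Counting the pairs \<open>(x', y)\<close> with \<open>x' \<noteq> x\<close> and
  \<open>y\<close> incident with both gives \<open>(v - 1) * l = r * (k - 1)\<close>, where
  \<open>r\<close> is the number sought. Comparison with \<open>params\<close> and cancellation of
  \<open>k - 1 > 0\<close> yield \<open>r = k\<close>.\<close>

lemma replication_of_2_design:
  assumes "finite X" "finite Y"
    and block: "\<And>y. y \<in> Y \<Longrightarrow> card {x \<in> X. I x y} = k"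
    and pairs: "\<And>x x'. x \<in> X \<Longrightarrow> x' \<in> X \<Longrightarrow> x \<noteq> x' \<Longrightarrow> card {y \<in> Y. I x y \<and> I x' y} = l"
    and card: "card X = v" and params: "l * (v - 1) = k * (k - 1)" and "k > 1"
    and "x \<in> X"
  shows "card {y \<in> Y. I x y} = k"
proof -
  define C where "C = {y \<in> Y. I x y}"
  have "card {x' \<in> X - {x}. I x' y} = k - 1" if "y \<in> C" for y
  proof -
    have "{x' \<in> X - {x}. I x' y} = {x \<in> X. I x y} - {x}"
      by auto
    then show ?thesis
      using that assms by (simp add: C_def)
  qed
  then have "(\<Sum>x'\<in>X - {x}. card {y \<in> C. I x' y}) = (\<Sum>y\<in>C. k - 1)"
    using assms by (intro sum_multicount_gen) (auto simp: C_def)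
  moreover have "card {y \<in> C. I x' y} = l" if "x' \<in> X - {x}" for x'
    using that pairs[of x x'] assms by (auto simp: C_def)
  ultimately have "(v - 1) * l = card C * (k - 1)"
    using assms by simp
  then show ?thesis
    using params \<open>k > 1\<close> by (simp add: C_def mult.commute)
qed

lemma card_fibres:
  assumes "finite A" "finite T" "g ` A \<subseteq> T"
  shows "card {z \<in> A. Q (g z) \<and> R z} = (\<Sum>t\<in>{t \<in> T. Q t}. card {z \<in> A. R z \<and> g z = t})"
proof -
  have "{z \<in> A. Q (g z) \<and> R z} = (\<Union>t\<in>{t \<in> T. Q t}. {z \<in> A. R z \<and> g z = t})"
    using assms by auto
  then show ?thesis
    using assms by (simp only:) (rule card_UN_disjoint, auto)
qed

subsection \<open>Graphs determined by traces on a clique\<close>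

text \<open>The traces are abstract labels in \<open>\<H>\<close>, so the collinearity graph and the
  modified graph differ only in the map from labels to subsets of the clique \<open>U\<close>. The
  relation \<open>R\<close> is the adjacency outside \<open>U\<close>, shared by both
  graphs.\<close>

locale projection_graph =
  fixes P U :: "'p set" and \<H> :: "'h set" and proj :: "'p \<Rightarrow> 'h" and R :: "'p \<Rightarrow> 'p \<Rightarrow> bool"
    and N b :: nat
  assumes finite_P: "finite P" and U_sub: "U \<subseteq> P" and finite_H: "finite \<H>"
    and proj_mem: "y \<in> P - U \<Longrightarrow> proj y \<in> \<H>"
    and card_fibre: "H \<in> \<H> \<Longrightarrow> card {y \<in> P - U. proj y = H} = N"
    and card_fibre_R: "y \<in> P - U \<Longrightarrow> H \<in> \<H> \<Longrightarrow> H \<noteq> proj y \<Longrightarrow>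
      card {z \<in> P - U. R y z \<and> proj z = H} = b"
begin

text \<open>With traces as labels, the identity map for \<open>\<phi>\<close> gives the collinearity
  graph.\<close>

definition adj :: "('h \<Rightarrow> 'p set) \<Rightarrow> 'p \<Rightarrow> 'p \<Rightarrow> bool" where
  "adj \<phi> x y \<longleftrightarrow>
     (x \<in> U \<and> y \<in> U \<and> x \<noteq> y) \<or>
     (x \<notin> U \<and> y \<notin> U \<and> R x y) \<or>
     (x \<in> U \<and> y \<notin> U \<and> x \<in> \<phi> (proj y)) \<or>
     (x \<notin> U \<and> y \<in> U \<and> y \<in> \<phi> (proj x))"

text \<open>A symmetric design with blocks indexed by \<open>\<H>\<close>. The two dual conditions,
  on the blocks through a point and on the intersection of two blocks, are included because the
  neighbour counts use all four numbers.\<close>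

definition block_system :: "('h \<Rightarrow> 'p set) \<Rightarrow> nat \<Rightarrow> nat \<Rightarrow> bool" where
  "block_system \<phi> k l \<longleftrightarrow>
     (\<forall>H\<in>\<H>. \<phi> H \<subseteq> U \<and> card (\<phi> H) = k) \<and>
     (\<forall>x\<in>U. card {H \<in> \<H>. x \<in> \<phi> H} = k) \<and>
     (\<forall>x\<in>U. \<forall>y\<in>U. x \<noteq> y \<longrightarrow> card {H \<in> \<H>. x \<in> \<phi> H \<and> y \<in> \<phi> H} = l) \<and>
     (\<forall>H\<in>\<H>. \<forall>H'\<in>\<H>. H \<noteq> H' \<longrightarrow> card (\<phi> H \<inter> \<phi> H') = l)"

lemma finite_U: "finite U"
  using finite_P U_sub finite_subset by blast

lemma card_split: "card {z \<in> P. Q z} = card {z \<in> U. Q z} + card {z \<in> P - U. Q z}"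
proof -
  have "{z \<in> P. Q z} = {z \<in> U. Q z} \<union> {z \<in> P - U. Q z}"
    using U_sub by auto
  moreover have "{z \<in> U. Q z} \<inter> {z \<in> P - U. Q z} = {}"
    by auto
  ultimately show ?thesis
    using finite_P finite_U by (simp add: card_Un_disjoint)
qed

lemma card_outside:
  "card {z \<in> P - U. Q (proj z) \<and> S z}
    = (\<Sum>H\<in>{H \<in> \<H>. Q H}. card {z \<in> P - U. S z \<and> proj z = H})"
  using card_fibres[of "P - U" \<H> proj Q S] finite_P finite_H proj_mem by auto

lemma card_outside_all: "card {z \<in> P - U. Q (proj z)} = card {H \<in> \<H>. Q H} * N"
proof -
  have "(\<Sum>H\<in>{H \<in> \<H>. Q H}. card {z \<in> P - U. proj z = H}) = (\<Sum>H\<in>{H \<in> \<H>. Q H}. N)"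
    using card_fibre by (intro sum.cong) auto
  then show ?thesis
    using card_outside[of Q "\<lambda>_. True"] by simp
qed

lemma degree_inside:
  assumes "block_system \<phi> k l" "x \<in> U"
  shows "card {z \<in> P. adj \<phi> x z} = (card U - 1) + k * N"
proof -
  have "{z \<in> U. adj \<phi> x z} = U - {x}"
    using assms by (auto simp: adj_def)
  moreover have "{z \<in> P - U. adj \<phi> x z} = {z \<in> P - U. x \<in> \<phi> (proj z)}"
    using assms by (auto simp: adj_def)
  ultimately show ?thesis
    using assms finite_U card_split[of "adj \<phi> x"] card_outside_all[of "\<lambda>H. x \<in> \<phi> H"]
    by (simp add: block_system_def)
qed

lemma common_inside:
  assumes "block_system \<phi> k l" "x \<in> U" "x' \<in> U" "x \<noteq> x'"
  shows "card {z \<in> P. adj \<phi> x z \<and> adj \<phi> x' z} = (card U - 2) + l * N"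
proof -
  have "{z \<in> U. adj \<phi> x z \<and> adj \<phi> x' z} = U - {x, x'}"
    using assms by (auto simp: adj_def)
  moreover have "{z \<in> P - U. adj \<phi> x z \<and> adj \<phi> x' z}
      = {z \<in> P - U. x \<in> \<phi> (proj z) \<and> x' \<in> \<phi> (proj z)}"
    using assms by (auto simp: adj_def)
  ultimately show ?thesis
    using assms finite_U card_split[of "\<lambda>z. adj \<phi> x z \<and> adj \<phi> x' z"]
      card_outside_all[of "\<lambda>H. x \<in> \<phi> H \<and> x' \<in> \<phi> H"]
    by (simp add: card_Diff_subset block_system_def)
qed

text \<open>The outer common neighbours are counted trace by trace over the \<open>k\<close> blocks
  through \<open>x\<close>. Every trace other than that of \<open>y\<close> contributes
  \<open>b\<close>. The contribution of the trace of \<open>y\<close> itself is left unevaluated,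
  since it is the same for every block system.\<close>

lemma common_mixed:
  assumes "block_system \<phi> k l" "x \<in> U" "y \<in> P - U"
  shows "card {z \<in> P. adj \<phi> x z \<and> adj \<phi> y z} =
    (if x \<in> \<phi> (proj y)
     then (k - 1) + card {z \<in> P - U. R y z \<and> proj z = proj y} + (k - 1) * b
     else k + k * b)"
proof -
  have "{z \<in> U. adj \<phi> x z \<and> adj \<phi> y z} = \<phi> (proj y) - {x}"
    using assms proj_mem[of y] by (auto simp: adj_def block_system_def)
  moreover have "finite (\<phi> (proj y))"
    using assms proj_mem[of y] finite_U by (auto simp: block_system_def intro: finite_subset)
  moreover have "{z \<in> P - U. adj \<phi> x z \<and> adj \<phi> y z} = {z \<in> P - U. x \<in> \<phi> (proj z) \<and> R y z}"
    using assms by (auto simp: adj_def)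
  ultimately have *: "card {z \<in> P. adj \<phi> x z \<and> adj \<phi> y z} =
      card (\<phi> (proj y) - {x}) +
      (\<Sum>H\<in>{H \<in> \<H>. x \<in> \<phi> H}. card {z \<in> P - U. R y z \<and> proj z = H})"
    using card_split[of "\<lambda>z. adj \<phi> x z \<and> adj \<phi> y z"] card_outside[of "\<lambda>H. x \<in> \<phi> H" "R y"]
    by simp
  have k: "card {H \<in> \<H>. x \<in> \<phi> H} = k" "card (\<phi> (proj y)) = k"
    using assms proj_mem[of y] by (auto simp: block_system_def)
  show ?thesis
  proof (cases "x \<in> \<phi> (proj y)")
    case True
    then have "proj y \<in> {H \<in> \<H>. x \<in> \<phi> H}"
      using assms proj_mem by auto
    moreover have "(\<Sum>H\<in>{H \<in> \<H>. x \<in> \<phi> H} - {proj y}. card {z \<in> P - U. R y z \<and> proj z = H})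
        = (\<Sum>H\<in>{H \<in> \<H>. x \<in> \<phi> H} - {proj y}. b)"
      using assms card_fibre_R by (intro sum.cong) auto
    ultimately show ?thesis
      using True * k finite_H by (simp add: sum.remove)
  next
    case False
    then have "(\<Sum>H\<in>{H \<in> \<H>. x \<in> \<phi> H}. card {z \<in> P - U. R y z \<and> proj z = H})
        = (\<Sum>H\<in>{H \<in> \<H>. x \<in> \<phi> H}. b)"
      using assms card_fibre_R by (intro sum.cong) auto
    then show ?thesis
      using False * k by simp
  qed
qed

lemma degree_outside:
  assumes "block_system \<phi> k l" "y \<in> P - U"
  shows "card {z \<in> P. adj \<phi> y z} = k + card {z \<in> P - U. R y z}"
proof -
  have "{z \<in> U. adj \<phi> y z} = \<phi> (proj y)"
    using assms proj_mem[of y] by (auto simp: adj_def block_system_def)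
  moreover have "{z \<in> P - U. adj \<phi> y z} = {z \<in> P - U. R y z}"
    using assms by (auto simp: adj_def)
  ultimately show ?thesis
    using assms proj_mem[of y] card_split[of "adj \<phi> y"] by (simp add: block_system_def)
qed

text \<open>As for the degree of an outer point, the block system enters only through
  \<open>k\<close> and \<open>l\<close>; the count outside \<open>U\<close> and the test whether the
  traces agree do not involve \<open>\<phi>\<close>.\<close>

lemma common_outside:
  assumes "block_system \<phi> k l" "y \<in> P - U" "y' \<in> P - U"
  shows "card {z \<in> P. adj \<phi> y z \<and> adj \<phi> y' z} =
    (if proj y = proj y' then k else l) + card {z \<in> P - U. R y z \<and> R y' z}"
proof -
  have "{z \<in> U. adj \<phi> y z \<and> adj \<phi> y' z} = \<phi> (proj y) \<inter> \<phi> (proj y')"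
    using assms proj_mem[of y] by (auto simp: adj_def block_system_def)
  moreover have "{z \<in> P - U. adj \<phi> y z \<and> adj \<phi> y' z} = {z \<in> P - U. R y z \<and> R y' z}"
    using assms by (auto simp: adj_def)
  ultimately show ?thesis
    using assms proj_mem[of y] proj_mem[of y'] card_split[of "\<lambda>z. adj \<phi> y z \<and> adj \<phi> y' z"]
    by (auto simp: block_system_def)
qed

end

subsection \<open>Formed spaces over finite fields\<close>

text \<open>The three kinds of forms are treated uniformly: \<open>f\<close> is the symplectic form, the polar form of the
  quadratic form, or the hermitian form, and \<open>sing\<close> selects the isotropic or singular vectors. Of
  \<open>f\<close> only linearity in the first argument and symmetry of orthogonality are needed.\<close>

locale formed_space = finite_dimensional_vector_space scale Basis
  for scale :: "'k::{field,finite} \<Rightarrow> 'v::ab_group_add \<Rightarrow> 'v"  (infixr \<open>*s\<close> 75)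
    and Basis :: "'v set" +
  fixes F :: "('k, 'v) form" and f :: "'v \<Rightarrow> 'v \<Rightarrow> 'k" and sing :: "'v \<Rightarrow> bool"
    and q :: nat
  assumes q: "q = CARD('k)"
    and f_add: "f (u + v) w = f u w + f v w"
    and f_scale: "f (a *s v) w = a * f v w"
    and f_reflexive: "f v w = 0 \<Longrightarrow> f w v = 0"
    and sing_0: "sing 0"
    and sing_scale: "sing v \<Longrightarrow> sing (a *s v)"
    and sing_add: "sing v \<Longrightarrow> sing w \<Longrightarrow> f v w = 0 \<Longrightarrow> sing (v + w)"
    and sing_self: "sing v \<Longrightarrow> f v v = 0"
    and sing_radical: "sing v \<Longrightarrow> (\<And>w. f v w = 0) \<Longrightarrow> v = 0"
    and sing_shift: "sing x \<Longrightarrow> f x w \<noteq> 0 \<Longrightarrow> \<exists>a. sing (w + a *s x)"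
    and vanishes_on_iff: "subspace T \<Longrightarrow>
      vanishes_on F T \<longleftrightarrow> (\<forall>v\<in>T. sing v) \<and> (\<forall>v\<in>T. \<forall>w\<in>T. f v w = 0)"
begin

lemma q_gt_1: "q > 1"
proof -
  have "card {0, 1 :: 'k} \<le> q"
    unfolding q by (rule card_mono) auto
  then show ?thesis
    by simp
qed

lemma card_nonzero: "card (UNIV - {0 :: 'k}) = q - 1"
  by (simp add: card_Diff_subset q)

section \<open>Subspaces of codimension one\<close>

lemma codim1_decomp:
  assumes "subspace S" "subspace T" "T \<subseteq> S" "dim S = Suc (dim T)" "a \<in> S" "a \<notin> T" "v \<in> S"
  obtains c where "v - c *s a \<in> T"
proof -
  have "dim (insert a T) = dim S"
    using assms by (simp add: dim_insert span_eq_iff[THEN iffD2])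
  moreover have "span (insert a T) \<subseteq> S"
    using assms by (intro span_minimal) auto
  ultimately have "span (insert a T) = S"
    using assms by (intro subspace_dim_equal) auto
  then show ?thesis
    using assms that by (auto simp: span_insert span_eq_iff[THEN iffD2])
qed

lemma codim1I:
  assumes "subspace S" "subspace T" "T \<subseteq> S" "a \<in> S" "a \<notin> T"
    and "\<And>v. v \<in> S \<Longrightarrow> \<exists>c. v - c *s a \<in> T"
  shows "dim S = Suc (dim T)"
proof -
  have T: "span T = T"
    using assms by (simp add: span_eq_iff)
  have "span (insert a T) = S"
  proof
    show "span (insert a T) \<subseteq> S"
      using assms by (intro span_minimal) auto
    show "S \<subseteq> span (insert a T)"
      using assms(6) by (auto simp: span_insert T)
  qed
  then have "dim S = dim (insert a T)"
    by (metis dim_span)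
  then show ?thesis
    using assms by (simp add: dim_insert T)
qed

lemma dim_insert_subspace: "subspace T \<Longrightarrow> a \<notin> T \<Longrightarrow> dim (span (insert a T)) = Suc (dim T)"
  by (simp add: dim_insert span_eq_iff[THEN iffD2])

section \<open>Counting vectors and projective points\<close>

lemma finite_span_card:
  assumes "finite B" "independent B"
  shows "finite (span B) \<and> card (span B) = q ^ card B"
  using assms
proof (induction B)
  case empty
  then show ?case
    by simp
next
  case (insert b B)
  then have ind: "independent B" and b: "b \<notin> span B"
    by (auto simp: independent_insert)
  \<comment> \<open>Coordinates along \<open>b\<close> are unique since \<open>b\<close> lies
    outside \<open>span B\<close>; each basis vector therefore contributes a factor
    \<open>q\<close>.\<close>
  have "bij_betw (\<lambda>(c, w). c *s b + w) (UNIV \<times> span B) (span (insert b B))"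
  proof (rule bij_betw_imageI)
    show "inj_on (\<lambda>(c, w). c *s b + w) (UNIV \<times> span B)"
    proof (rule inj_onI, clarify)
      fix c w c' w'
      assume w: "w \<in> span B" "w' \<in> span B" and eq: "c *s b + w = c' *s b + w'"
      have "(c - c') *s b = w' - w"
        using eq by (simp add: scale_left_diff_distrib algebra_simps)
      then have "(c - c') *s b \<in> span B"
        using w by (simp add: span_diff)
      then have "c - c' = 0"
        using b span_scale[of "(c - c') *s b" B "inverse (c - c')"] by (cases "c - c' = 0") auto
      then show "c = c' \<and> w = w'"
        using eq by simp
    qed
    show "(\<lambda>(c, w). c *s b + w) ` (UNIV \<times> span B) = span (insert b B)"
    proof (intro equalityI subsetI)
      fix x
      assume "x \<in> (\<lambda>(c, w). c *s b + w) ` (UNIV \<times> span B)"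
      then obtain c w where "w \<in> span B" "x = c *s b + w"
        by auto
      then show "x \<in> span (insert b B)"
        by (auto simp: span_insert intro!: exI[of _ c])
    next
      fix x
      assume "x \<in> span (insert b B)"
      then obtain c where "x - c *s b \<in> span B"
        by (auto simp: span_insert)
      then show "x \<in> (\<lambda>(c, w). c *s b + w) ` (UNIV \<times> span B)"
        by (intro image_eqI[of _ _ "(c, x - c *s b)"]) auto
    qed
  qed
  moreover have "finite (span B)" "card (span B) = q ^ card B"
    using insert ind by auto
  ultimately show ?case
    using insert by (auto simp: card_cartesian_product q dest: bij_betw_same_card bij_betw_finite)
qed

lemma finite_vectors: "finite (S :: 'v set)"
proof -
  have "finite (span Basis)"
    using finite_span_card finite_Basis independent_Basis by blast
  then show ?thesis
    by (metis finite_subset span_Basis subset_UNIV)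
qed

lemma card_subspace: "subspace T \<Longrightarrow> card T = q ^ dim T"
  using finite_span_card basis_exists[of T] finite_vectors
  by (metis basis_card_eq_dim span_subspace)

lemma span_singleton_eq_iff:
  assumes "u \<noteq> 0" "v \<noteq> 0"
  shows "span {u} = span {v} \<longleftrightarrow> (\<exists>c. c \<noteq> 0 \<and> v = c *s u)"
proof
  assume "span {u} = span {v}"
  then have "v \<in> span {u}"
    by (simp add: span_base)
  then show "\<exists>c. c \<noteq> 0 \<and> v = c *s u"
    using assms by (auto simp: span_singleton)
next
  assume "\<exists>c. c \<noteq> 0 \<and> v = c *s u"
  then obtain c where "c \<noteq> 0" "v = c *s u"
    by blast
  then have "v \<in> span {u}" "u \<in> span {v}"
    using span_scale[of v "{v}" "inverse c"] by (auto simp: span_base span_scale)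
  then show "span {u} = span {v}"
    by (simp add: span_eq)
qed

text \<open>Each point of the image is represented by the \<open>q - 1\<close> nonzero multiples of
  one vector, all of which lie in \<open>S\<close>. This turns counts of vectors into counts of
  points.\<close>

lemma card_points_of_cone:
  assumes "0 \<notin> S" "\<And>c v. c \<noteq> 0 \<Longrightarrow> v \<in> S \<Longrightarrow> c *s v \<in> S"
  shows "card S = (q - 1) * card ((\<lambda>v. span {v}) ` S)"
proof -
  have fibre: "card {v \<in> S. span {v} = p} = q - 1" if "p \<in> (\<lambda>v. span {v}) ` S" for p
  proof -
    obtain u where u: "u \<in> S" "p = span {u}"
      using \<open>p \<in> _\<close> by auto
    then have "u \<noteq> 0"
      using assms by auto
    have "{v \<in> S. span {v} = p} = (\<lambda>c. c *s u) ` (UNIV - {0})"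
    proof (intro equalityI subsetI)
      fix v
      assume v: "v \<in> {v \<in> S. span {v} = p}"
      then have "v \<noteq> 0"
        using assms by auto
      then show "v \<in> (\<lambda>c. c *s u) ` (UNIV - {0})"
        using v u \<open>u \<noteq> 0\<close> span_singleton_eq_iff[of u v] by auto
    next
      fix v
      assume "v \<in> (\<lambda>c. c *s u) ` (UNIV - {0})"
      then obtain c where "c \<noteq> 0" "v = c *s u"
        by auto
      then show "v \<in> {v \<in> S. span {v} = p}"
        using assms u \<open>u \<noteq> 0\<close> span_singleton_eq_iff[of u v] by auto
    qed
    moreover have "inj_on (\<lambda>c. c *s u) (UNIV - {0})"
      using \<open>u \<noteq> 0\<close> by (auto intro: inj_onI)
    ultimately show ?thesis
      by (simp add: card_image card_nonzero)
  qed
  have "card S = (\<Sum>p\<in>(\<lambda>v. span {v}) ` S. card {v \<in> S. span {v} = p})"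
    using sum.image_gen[of S "\<lambda>_. 1::nat" "\<lambda>v. span {v}"] finite_vectors by simp
  then show ?thesis
    using fibre by simp
qed

lemma dim_1_iff: "subspace p \<and> dim p = 1 \<longleftrightarrow> (\<exists>u. u \<noteq> 0 \<and> p = span {u})"
proof
  assume p: "subspace p \<and> dim p = 1"
  then have "\<not> p \<subseteq> {0}"
    by (metis dim_eq_0 zero_neq_one)
  then obtain u where "u \<in> p" "u \<noteq> 0"
    by auto
  moreover from this have "span {u} = p"
    using p by (intro subspace_dim_equal) (auto simp: span_minimal)
  ultimately show "\<exists>u. u \<noteq> 0 \<and> p = span {u}"
    by auto
qed auto

lemma span_singleton_subset_iff: "subspace T \<Longrightarrow> span {u} \<subseteq> T \<longleftrightarrow> u \<in> T"
  by (metis empty_subsetI insert_subset span_base span_minimal subsetD singletonI)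

lemma proj_points_eq: "subspace T \<Longrightarrow> proj_points T = (\<lambda>v. span {v}) ` (T - {0})"
proof -
  assume T: "subspace T"
  have "proj_points T = {p. (\<exists>u. u \<noteq> 0 \<and> p = span {u}) \<and> p \<subseteq> T}"
    unfolding proj_points_def dim_1_iff[symmetric] by blast
  then show ?thesis
    using span_singleton_subset_iff[OF T] by auto
qed

lemma span_in_proj_points: "subspace T \<Longrightarrow> u \<noteq> 0 \<Longrightarrow> span {u} \<in> proj_points T \<longleftrightarrow> u \<in> T"
  unfolding proj_points_def using dim_1_iff[of "span {u}"] span_singleton_subset_iff[of T] by auto

lemma proj_points_inject:
  "subspace S \<Longrightarrow> subspace T \<Longrightarrow> proj_points S = proj_points T \<longleftrightarrow> S = T"
proof
  assume *: "subspace S" "subspace T" "proj_points S = proj_points T"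
  then have "v \<in> S \<longleftrightarrow> v \<in> T" for v
    using span_in_proj_points[of S v] span_in_proj_points[of T v]
    by (cases "v = 0") (auto simp: subspace_0)
  then show "S = T"
    by blast
qed auto

lemma proj_points_Int: "proj_points S \<inter> proj_points T = proj_points (S \<inter> T)"
  by (auto simp: proj_points_def)

lemma card_proj_points: "subspace T \<Longrightarrow> card (proj_points T) = (q ^ dim T - 1) div (q - 1)"
proof -
  assume T: "subspace T"
  have "card (T - {0}) = (q - 1) * card (proj_points T)"
    unfolding proj_points_eq[OF T] by (rule card_points_of_cone) (use T in \<open>auto simp: subspace_scale\<close>)
  moreover have "card (T - {0}) = q ^ dim T - 1"
    using T card_subspace finite_vectors by (simp add: subspace_0)
  ultimately show ?thesis
    using q_gt_1 by simp
qed

section \<open>Orthogonality and totally isotropic subspaces\<close>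

lemma f_sym_0: "f v w = 0 \<longleftrightarrow> f w v = 0"
  using f_reflexive by blast

lemma f_zero: "f 0 w = 0"
  using f_scale[of 0 0 w] by simp

lemma f_diff: "f (u - v) w = f u w - f v w"
  using f_add[of "u - v" v w] by simp

lemma subspace_f_left: "subspace {v. f v w = 0}"
  by (auto simp: subspace_def f_add f_scale f_zero)

lemma subspace_f_right: "subspace {v. f w v = 0}"
  using subspace_f_left[of w] by (simp add: f_sym_0[of _ w])

lemma isotropic_iff:
  "totally_isotropic F T \<longleftrightarrow> subspace T \<and> (\<forall>v\<in>T. sing v) \<and> (\<forall>v\<in>T. \<forall>w\<in>T. f v w = 0)"
  unfolding totally_isotropic_def using vanishes_on_iff by blast

lemma f_span_right:
  assumes "\<And>s. s \<in> S \<Longrightarrow> f v s = 0" "w \<in> span S"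
  shows "f v w = 0"
  using span_minimal[of S "{w. f v w = 0}"] assms subspace_f_right by auto

text \<open>Sums of singular vectors are singular only under orthogonality, so the orthogonality of
  the whole span is proved first and then used in an induction over linear combinations.\<close>

lemma isotropic_span:
  assumes "\<And>v. v \<in> S \<Longrightarrow> sing v" "\<And>v w. v \<in> S \<Longrightarrow> w \<in> S \<Longrightarrow> f v w = 0"
  shows "totally_isotropic F (span S)"
proof -
  have 1: "f v w = 0" if "v \<in> S" "w \<in> span S" for v w
    using f_span_right assms(2) that by blast
  then have 2: "f w v = 0" if "v \<in> span S" "w \<in> span S" for v w
    using f_span_right[of S w v] f_sym_0 that by blast
  have "v \<in> span S \<and> sing v" if "v \<in> span S" for v
    using that
  proof (induction rule: span_induct_alt)
    case base
    show ?case
      by (simp add: sing_0 span_zero)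
  next
    case (step c x y)
    then have "f (c *s x) y = 0"
      using 1 by (simp add: f_scale)
    then show ?case
      using step assms(1) by (simp add: sing_add sing_scale span_add span_base span_scale)
  qed
  then show ?thesis
    using 2 by (auto simp: isotropic_iff)
qed

lemma isotropic_insert:
  assumes "totally_isotropic F T" "sing y" "\<And>v. v \<in> T \<Longrightarrow> f v y = 0"
  shows "totally_isotropic F (span (insert y T))"
  using assms sing_self f_sym_0 by (intro isotropic_span) (auto simp: isotropic_iff)

lemma polar_points_iff: "p \<in> polar_points F \<longleftrightarrow> (\<exists>u. u \<noteq> 0 \<and> sing u \<and> p = span {u})"
proof
  assume "p \<in> polar_points F"
  then have "totally_isotropic F p" "subspace p \<and> dim p = 1"
    by (auto simp: polar_points_def isotropic_iff)
  then show "\<exists>u. u \<noteq> 0 \<and> sing u \<and> p = span {u}"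
    unfolding dim_1_iff by (auto simp: isotropic_iff span_base)
next
  assume "\<exists>u. u \<noteq> 0 \<and> sing u \<and> p = span {u}"
  then show "p \<in> polar_points F"
    using isotropic_span[of "{_}"] sing_self by (auto simp: polar_points_def)
qed

lemma proj_points_isotropic: "totally_isotropic F T \<Longrightarrow> proj_points T \<subseteq> polar_points F"
  using polar_points_iff by (auto simp: isotropic_iff proj_points_eq)

lemma collinear_iff:
  assumes "u \<noteq> 0" "sing u" "v \<noteq> 0" "sing v" "span {u} \<noteq> span {v}"
  shows "collinear_points F (span {u}) (span {v}) \<longleftrightarrow> f u v = 0"
proof
  assume "collinear_points F (span {u}) (span {v})"
  then obtain L where "totally_isotropic F L" "span {u} \<subseteq> L" "span {v} \<subseteq> L"
    by (auto simp: collinear_points_def polar_lines_def)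
  then show "f u v = 0"
    by (auto simp: isotropic_iff span_base subset_iff)
next
  assume "f u v = 0"
  then have iso: "totally_isotropic F (span {u, v})"
    using assms sing_self f_sym_0 by (intro isotropic_span) auto
  have "u \<notin> span {v}"
  proof
    assume "u \<in> span {v}"
    then obtain c where "u = c *s v"
      by (auto simp: span_singleton)
    then show False
      using assms span_singleton_eq_iff[of v u] by auto
  qed
  then have "dim (span {u, v}) = 2"
    using assms by (simp add: dim_insert)
  then show "collinear_points F (span {u}) (span {v})"
    using iso assms polar_points_iff span_mono[of "{u}" "{u, v}"] span_mono[of "{v}" "{u, v}"]
    unfolding collinear_points_def polar_lines_def by blast
qed

text \<open>Equal points need a separate argument: a point lies in its own \<open>perp\<close> by
  definition, and \<open>f u v = 0\<close> then holds because \<open>u\<close> is singular and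
  \<open>v\<close> is a multiple of it.\<close>

lemma perp_iff:
  assumes "u \<noteq> 0" "sing u" "v \<noteq> 0" "sing v"
  shows "span {v} \<in> perp F (span {u}) \<longleftrightarrow> f u v = 0"
proof (cases "span {u} = span {v}")
  case True
  then have "v \<in> span {u}"
    by (simp add: span_base)
  then have "f u v = 0"
    using assms sing_self f_span_right[of "{u}"] by auto
  then show ?thesis
    using True by (simp add: perp_def)
next
  case False
  then show ?thesis
    using assms collinear_iff by (auto simp: perp_def)
qed

section \<open>Singular subspaces and the rank\<close>

lemma isotropic_span_Union:
  assumes "X \<subseteq> polar_points F" "\<And>x y. x \<in> X \<Longrightarrow> y \<in> X \<Longrightarrow> x \<noteq> y \<Longrightarrow> collinear_points F x y"
  shows "totally_isotropic F (span (\<Union>X))"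
proof (rule isotropic_span)
  show "sing v" if "v \<in> \<Union>X" for v
    using that assms by (auto simp: polar_points_def isotropic_iff)
  show "f v w = 0" if vw: "v \<in> \<Union>X" "w \<in> \<Union>X" for v w
  proof -
    obtain x y where xy: "x \<in> X" "y \<in> X" "v \<in> x" "w \<in> y"
      using vw by auto
    \<comment> \<open>Both vectors lie in one totally isotropic subspace: a line through the two
      points, or the point itself when they coincide.\<close>
    have "\<exists>L. totally_isotropic F L \<and> x \<subseteq> L \<and> y \<subseteq> L"
    proof (cases "x = y")
      case True
      then show ?thesis
        using xy assms(1) by (auto simp: polar_points_def)
    next
      case False
      then show ?thesis
        using xy assms(2)[of x y] by (auto simp: collinear_points_def polar_lines_def)
    qed
    then show ?thesis
      using xy by (meson isotropic_iff subsetD)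
  qed
qed

text \<open>A line through two distinct points of \<open>T\<close> is spanned by them, so it stays
  inside \<open>T\<close>.\<close>

lemma singular_proj_points:
  assumes "totally_isotropic F T"
  shows "singular_subspace F (proj_points T)"
  unfolding singular_subspace_def
proof (intro conjI ballI impI)
  have T: "subspace T" "\<And>v. v \<in> T \<Longrightarrow> sing v" "\<And>v w. v \<in> T \<Longrightarrow> w \<in> T \<Longrightarrow> f v w = 0"
    using assms by (auto simp: isotropic_iff)
  show "proj_points T \<subseteq> polar_points F"
    using assms by (rule proj_points_isotropic)
  show "collinear_points F x y" if xy: "x \<in> proj_points T" "y \<in> proj_points T" "x \<noteq> y" for x y
  proof -
    obtain u v where "u \<noteq> 0" "x = span {u}" "u \<in> T" "v \<noteq> 0" "y = span {v}" "v \<in> T"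
      using xy T by (auto simp: proj_points_eq)
    then show ?thesis
      using xy T collinear_iff[of u v] by blast
  qed
  show "proj_points L \<subseteq> proj_points T"
    if xy: "x \<in> proj_points T" "y \<in> proj_points T" and L: "L \<in> polar_lines F" "x \<noteq> y \<and> x \<subseteq> L \<and> y \<subseteq> L"
    for x y L
  proof -
    have L': "subspace L" "dim L = 2"
      using L by (auto simp: polar_lines_def isotropic_iff)
    obtain u v where u: "u \<noteq> 0" "x = span {u}" "u \<in> T" and v: "v \<noteq> 0" "y = span {v}" "v \<in> T"
      using xy T by (auto simp: proj_points_eq)
    have "u \<notin> span {v}"
      using u v L span_singleton_eq_iff[of v u] by (auto simp: span_singleton)
    then have "dim (span {u, v}) = 2"
      using v by (simp add: dim_insert)
    moreover have "span {u, v} \<subseteq> L"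
      using L L' u v by (intro span_minimal) (auto simp: span_base subset_iff)
    ultimately have "span {u, v} = L"
      using L' by (intro subspace_dim_equal) auto
    moreover have "span {u, v} \<subseteq> T"
      using u v T by (intro span_minimal) auto
    ultimately show ?thesis
      by (auto simp: proj_points_def)
  qed
qed

lemma finite_points: "finite (S :: 'v set set)"
proof (rule finite_subset)
  show "S \<subseteq> Pow UNIV"
    by auto
  show "finite (Pow (UNIV :: 'v set))"
    by (intro finite_Pow_iff[THEN iffD2] finite_vectors)
qed

text \<open>\<open>has_rank\<close> speaks about maximal singular sets of points. By finiteness the
  points of \<open>T\<close> lie in such a set, and the span of its union is the desired
  subspace.\<close>

lemma maximal_isotropic_extension:
  assumes "has_rank F d" "totally_isotropic F T"
  obtains M where "totally_isotropic F M" "T \<subseteq> M" "dim M = d"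
proof -
  let ?C = "{X. singular_subspace F X \<and> proj_points T \<subseteq> X}"
  have "finite ?C"
  proof (rule finite_subset)
    show "?C \<subseteq> Pow UNIV"
      by auto
    show "finite (Pow (UNIV :: 'v set set))"
      by (intro finite_Pow_iff[THEN iffD2] finite_points)
  qed
  moreover have "proj_points T \<in> ?C"
    using assms singular_proj_points by simp
  ultimately have "\<exists>X\<in>?C. proj_points T \<subseteq> X \<and> (\<forall>Y\<in>?C. X \<subseteq> Y \<longrightarrow> X = Y)"
    by (rule finite_has_maximal2)
  then obtain X where X0: "X \<in> ?C" "\<forall>Y\<in>?C. X \<subseteq> Y \<longrightarrow> X = Y"
    by (elim bexE conjE)
  then have X: "singular_subspace F X" "proj_points T \<subseteq> X"
    by simp_all
  have "Y = X" if "singular_subspace F Y" "X \<subseteq> Y" for Y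
  proof -
    have "proj_points T \<subseteq> Y"
      using X(2) that(2) by (rule subset_trans)
    then have "Y \<in> ?C"
      using that(1) by simp
    then have "X = Y"
      using X0(2) that(2) by simp
    then show ?thesis
      by simp
  qed
  then have "maximal_singular_subspace F X"
    unfolding maximal_singular_subspace_def using X(1) by simp
  then have "dim (span (\<Union>X)) = d"
    using assms by (simp add: has_rank_def)
  moreover have "totally_isotropic F (span (\<Union>X))"
    using X(1) by (intro isotropic_span_Union) (simp_all add: singular_subspace_def)
  moreover have "T \<subseteq> span (\<Union>X)"
  proof
    fix v
    assume "v \<in> T"
    show "v \<in> span (\<Union>X)"
    proof (cases "v = 0")
      case False
      then have "span {v} \<in> X"
        using X(2) \<open>v \<in> T\<close> assms(2) span_in_proj_points[of T v] by (auto simp: isotropic_iff)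
      moreover have "v \<in> span {v}"
        by (simp add: span_base)
      ultimately have "v \<in> \<Union>X"
        by (rule UnionI)
      then show ?thesis
        by (rule span_base)
    qed (simp add: span_zero)
  qed
  ultimately show ?thesis
    using that by blast
qed

section \<open>Singular vectors orthogonal to a given set\<close>

definition sperp :: "'v set \<Rightarrow> 'v set" where
  "sperp S = {z. sing z \<and> (\<forall>s\<in>S. f z s = 0)}"

lemma sperp_span: "sperp (span S) = sperp S"
  using f_span_right[of S] span_base[of _ S] by (auto simp: sperp_def)

text \<open>Since \<open>h\<close> belongs to \<open>S\<close>, it is orthogonal to
  \<open>z\<close>, so the translate stays singular; since \<open>h\<close> is orthogonal to
  \<open>S\<close>, the translate stays orthogonal to \<open>S\<close>.\<close>

lemma sperp_add_scale:
  assumes "z \<in> sperp S" "h \<in> S" "sing h" "\<And>s. s \<in> S \<Longrightarrow> f h s = 0"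
  shows "z + c *s h \<in> sperp S"
proof -
  have "f z h = 0"
    using assms by (auto simp: sperp_def)
  then have "f z (c *s h) = 0"
    using f_sym_0 by (metis f_scale mult_zero_right)
  then show ?thesis
    using assms by (auto simp: sperp_def f_add f_scale intro: sing_add sing_scale)
qed

text \<open>Each orbit of the translations by multiples of \<open>h\<close> meets the kernel of \<open>\<lambda>z. f z y\<close> exactly
  once.\<close>

lemma card_translation_closed:
  assumes closed: "\<And>z c. z \<in> S \<Longrightarrow> z + c *s h \<in> S" and "f h y \<noteq> 0"
  shows "card S = q * card {z \<in> S. f z y = 0}"
proof -
  have "bij_betw (\<lambda>(c, z). z + c *s h) (UNIV \<times> {z \<in> S. f z y = 0}) S"
  proof (rule bij_betw_imageI)
    show "inj_on (\<lambda>(c, z). z + c *s h) (UNIV \<times> {z \<in> S. f z y = 0})"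
    proof (rule inj_onI, clarify)
      fix c z c' z'
      assume "f z y = 0" "f z' y = 0" and eq: "z + c *s h = z' + c' *s h"
      then have "c * f h y = c' * f h y"
        by (metis add_0 f_add f_scale)
      then show "c = c' \<and> z = z'"
        using eq \<open>f h y \<noteq> 0\<close> by simp
    qed
    show "(\<lambda>(c, z). z + c *s h) ` (UNIV \<times> {z \<in> S. f z y = 0}) = S"
    proof (intro equalityI subsetI)
      fix z
      assume "z \<in> S"
      define c where "c = f z y / f h y"
      have "z + (- c) *s h \<in> S"
        using closed \<open>z \<in> S\<close> by blast
      moreover have "f (z + (- c) *s h) y = 0"
        using \<open>f h y \<noteq> 0\<close> unfolding f_add f_scale by (simp add: c_def)
      ultimately show "z \<in> (\<lambda>(c, z). z + c *s h) ` (UNIV \<times> {z \<in> S. f z y = 0})"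
        by (intro image_eqI[of _ _ "(c, z + (- c) *s h)"]) auto
    qed (use closed in auto)
  qed
  then show ?thesis
    by (auto simp: card_cartesian_product q dest: bij_betw_same_card)
qed

text \<open>Translations by multiples of \<open>a\<close> preserve
  \<open>sperp (insert a K)\<close>, while \<open>f a b \<noteq> 0\<close> makes
  \<open>f z b\<close> take each value once on every orbit. Requiring orthogonality to
  \<open>b\<close> thus divides the size by \<open>q\<close>.\<close>

lemma card_sperp_insert:
  assumes "sing a" "\<And>s. s \<in> K \<Longrightarrow> f a s = 0" "f a b \<noteq> 0"
  shows "card (sperp (insert a K)) = q * card (sperp (insert b (insert a K)))"
proof -
  have "card (sperp (insert a K)) = q * card {z \<in> sperp (insert a K). f z b = 0}"
    by (rule card_translation_closed[of _ a])
      (use assms sing_self in \<open>auto intro!: sperp_add_scale\<close>)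
  moreover have "{z \<in> sperp (insert a K). f z b = 0} = sperp (insert b (insert a K))"
    by (auto simp: sperp_def)
  ultimately show ?thesis
    by simp
qed

text \<open>Both sides are \<open>q\<close> times the number of singular vectors orthogonal to
  \<open>a\<close>, \<open>b\<close> and \<open>K\<close>.\<close>

lemma card_sperp_exchange:
  assumes "sing a" "\<And>s. s \<in> K \<Longrightarrow> f a s = 0" "sing b" "\<And>s. s \<in> K \<Longrightarrow> f b s = 0" "f a b \<noteq> 0"
  shows "card (sperp (insert a K)) = card (sperp (insert b K))"
proof -
  have "f b a \<noteq> 0"
    using assms f_sym_0 by blast
  then show ?thesis
    using card_sperp_insert[of a K b] card_sperp_insert[of b K a] assms
    by (simp add: insert_commute)
qed

text \<open>Nondegeneracy separates a vector of \<open>T\<close> from a subspace not containing it.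
  The induction removes the elements of \<open>S\<close> one at a time by Gaussian elimination.
  Staying inside \<open>T\<close> keeps the vector singular, as the base case with
  \<open>sing_radical\<close> demands.\<close>

lemma functional_witness:
  assumes "totally_isotropic F T" "finite S" "S \<subseteq> T" "x \<in> T" "x \<notin> span S"
  obtains w where "\<And>s. s \<in> S \<Longrightarrow> f w s = 0" "f w x \<noteq> 0"
proof -
  have T: "subspace T" "\<And>v. v \<in> T \<Longrightarrow> sing v"
    using assms by (auto simp: isotropic_iff)
  have "\<exists>w. (\<forall>s\<in>S. f w s = 0) \<and> f w x \<noteq> 0"
    using assms(2-5)
  proof (induction S arbitrary: x)
    case empty
    then have "sing x" "x \<noteq> 0"
      using T by auto
    then show ?case
      using sing_radical[of x] f_sym_0 by blast
  next
    case (insert h S)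
    have "x \<notin> span S"
      using insert.prems span_mono[of S "insert h S"] by auto
    then obtain w1 where w1: "\<forall>s\<in>S. f w1 s = 0" "f w1 x \<noteq> 0"
      using insert by blast
    show ?case
    proof (cases "f w1 h = 0")
      case True
      then show ?thesis
        using w1 by blast
    next
      case False
      then have h: "f h w1 \<noteq> 0"
        using f_sym_0 by blast
      \<comment> \<open>The multiple of \<open>h\<close> is chosen to make \<open>x'\<close>
        orthogonal to \<open>w1\<close>.\<close>
      define x' where "x' = x - (f x w1 / f h w1) *s h"
      have "x' \<notin> span S"
        using insert.prems by (auto simp: x'_def span_insert)
      moreover have "x' \<in> T"
        using insert.prems T by (auto simp: x'_def subspace_diff subspace_scale)
      ultimately obtain w2 where w2: "\<forall>s\<in>S. f w2 s = 0" "f w2 x' \<noteq> 0"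
        using insert by blast
      \<comment> \<open>The multiple of \<open>w1\<close> is chosen to make \<open>w\<close>
        orthogonal to \<open>h\<close>. As \<open>w1\<close> is orthogonal to \<open>x'\<close>, the
        correction leaves the value at \<open>x'\<close> unchanged; and \<open>w\<close> cannot be
        orthogonal to \<open>x\<close>, since it would then be orthogonal to
        \<open>x'\<close>.\<close>
      define w where "w = w2 - (f w2 h / f w1 h) *s w1"
      have wS: "\<forall>s\<in>insert h S. f w s = 0"
        using w1 w2 False by (simp add: w_def f_diff f_scale)
      have "f x' w1 = 0"
        using h by (simp add: x'_def f_diff f_scale)
      then have "f w x' \<noteq> 0"
        using w2 f_sym_0[of w1 x'] by (simp add: w_def f_diff f_scale)
      moreover have "f x' w = 0" if "f w x = 0"
        using that wS f_sym_0[of w] by (simp add: x'_def f_diff f_scale)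
      ultimately show ?thesis
        using wS f_sym_0 by blast
    qed
  qed
  then show ?thesis
    using that by blast
qed

text \<open>A separating vector \<open>w\<close> becomes singular after adding a multiple of
  \<open>x\<close> by \<open>sing_shift\<close>. The values on \<open>T\<close> do not change
  because \<open>x\<close> is orthogonal to \<open>T\<close>.\<close>

lemma singular_witness:
  assumes "totally_isotropic F T" "subspace A" "A \<subseteq> T" "x \<in> T" "x \<notin> A"
  obtains y where "sing y" "\<And>a. a \<in> A \<Longrightarrow> f y a = 0" "f y x \<noteq> 0"
proof -
  have T: "sing x" "\<And>v w. v \<in> T \<Longrightarrow> w \<in> T \<Longrightarrow> f v w = 0"
    using assms by (auto simp: isotropic_iff)
  obtain w where w: "\<And>a. a \<in> A \<Longrightarrow> f w a = 0" "f w x \<noteq> 0"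
    using functional_witness[OF assms(1) finite_vectors, of A x] assms by (auto simp: span_eq_iff[THEN iffD2])
  then obtain c where "sing (w + c *s x)"
    using sing_shift[of x w] T f_sym_0 by blast
  moreover have "f (w + c *s x) a = 0" if "a \<in> A" for a
    using that w T assms by (auto simp: f_add f_scale)
  moreover have "f (w + c *s x) x \<noteq> 0"
    using w T assms by (auto simp: f_add f_scale)
  ultimately show ?thesis
    using that by blast
qed

end

section \<open>Generators and their hyperplanes\<close>

locale polar_space = formed_space scale Basis F f sing q
  for scale :: "'k::{field,finite} \<Rightarrow> 'v::ab_group_add \<Rightarrow> 'v"  (infixr \<open>*s\<close> 75)
    and Basis F f sing q +
  fixes d :: nat
  assumes rank: "has_rank F d" and rank_ge: "d \<ge> 3"
begin

definition generator :: "'v set \<Rightarrow> bool" where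
  "generator W \<longleftrightarrow> totally_isotropic F W \<and> dim W = d"

text \<open>The vector counterpart of \<open>hyperplanes\<close>, whose members are sets of points;
  \<open>proj_points\<close> leads from one to the other.\<close>

definition hyper :: "'v set \<Rightarrow> 'v set \<Rightarrow> bool" where
  "hyper A W \<longleftrightarrow> subspace A \<and> A \<subseteq> W \<and> Suc (dim A) = dim W"

lemma generatorD:
  assumes "generator W"
  shows "totally_isotropic F W" "subspace W" "dim W = d" "\<And>v. v \<in> W \<Longrightarrow> sing v"
    "\<And>v w. v \<in> W \<Longrightarrow> w \<in> W \<Longrightarrow> f v w = 0"
  using assms by (auto simp: generator_def isotropic_iff)

lemma generator_extension:
  assumes "totally_isotropic F T"
  obtains M where "generator M" "T \<subseteq> M"
  using maximal_isotropic_extension[OF rank assms] by (auto simp: generator_def)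

lemma dim_isotropic_le: "totally_isotropic F T \<Longrightarrow> dim T \<le> d"
  by (metis generator_extension generatorD(3) dim_subset)

text \<open>Otherwise \<open>y\<close> and \<open>W\<close> would span a totally isotropic subspace
  of dimension \<open>d + 1\<close>.\<close>

lemma generator_maximal:
  assumes "generator W" "sing y" "\<And>v. v \<in> W \<Longrightarrow> f v y = 0"
  shows "y \<in> W"
proof (rule ccontr)
  assume "y \<notin> W"
  then have "dim (span (insert y W)) = Suc d"
    using generatorD(2,3)[OF assms(1)] dim_insert_subspace[of W y] by simp
  moreover have "totally_isotropic F (span (insert y W))"
    using generatorD[OF assms(1)] assms by (intro isotropic_insert) auto
  ultimately show False
    using dim_isotropic_le by fastforce
qed

text \<open>By maximality of \<open>W\<close> the functional \<open>\<lambda>w. f w y\<close> is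
  nonzero on \<open>W\<close>, so its kernel has codimension one.\<close>

lemma hyper_perp:
  assumes "generator W" "sing y" "y \<notin> W"
  shows "hyper {w \<in> W. f w y = 0} W"
proof -
  note W = generatorD[OF assms(1)]
  obtain x where x: "x \<in> W" "f x y \<noteq> 0"
    using generator_maximal assms by blast
  have sub: "subspace {w \<in> W. f w y = 0}"
    using subspace_inter[OF W(2) subspace_f_left[of y]] by (simp add: Int_def)
  have "dim W = Suc (dim {w \<in> W. f w y = 0})"
  proof (rule codim1I[of _ _ x])
    fix v
    assume "v \<in> W"
    then show "\<exists>c. v - c *s x \<in> {w \<in> W. f w y = 0}"
      using x W by (intro exI[of _ "f v y / f x y"]) (simp add: f_diff f_scale subspace_diff subspace_scale)
  qed (use W x sub in auto)
  then show ?thesis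
    using sub by (auto simp: hyper_def)
qed

lemma hyper_eqI: "hyper A W \<Longrightarrow> hyper B W \<Longrightarrow> A \<subseteq> B \<Longrightarrow> A = B"
  unfolding hyper_def by (intro subspace_dim_equal) auto

lemma hyper_decomp:
  assumes "generator W" "hyper A W" "hyper B W" "h \<in> A" "h \<notin> B"
  shows "A = span (insert h (A \<inter> B))" "Suc (dim (A \<inter> B)) = dim A"
proof -
  note W = generatorD[OF assms(1)]
  have dec: "\<exists>c. v - c *s h \<in> A \<inter> B" if v: "v \<in> A" for v
  proof -
    obtain c where "v - c *s h \<in> B"
      by (rule codim1_decomp[of W B h v]) (use assms W v in \<open>auto simp: hyper_def\<close>)
    then show ?thesis
      using assms that by (auto simp: hyper_def subspace_diff subspace_scale)
  qed
  have sub: "subspace A" "subspace (A \<inter> B)"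
    using assms by (auto simp: hyper_def subspace_inter)
  show "A = span (insert h (A \<inter> B))"
  proof
    show "A \<subseteq> span (insert h (A \<inter> B))"
      using dec sub by (auto simp: span_insert span_eq_iff[THEN iffD2])
    show "span (insert h (A \<inter> B)) \<subseteq> A"
      using assms sub by (intro span_minimal) auto
  qed
  show "Suc (dim (A \<inter> B)) = dim A"
    using codim1I[of A "A \<inter> B" h] dec assms sub by auto
qed

text \<open>With \<open>K = A \<inter> B\<close>, the hyperplanes are spanned by \<open>K\<close>
  together with \<open>h\<close> and \<open>h'\<close> respectively. These are orthogonal, so
  \<open>card_sperp_exchange\<close> cannot swap them directly; a singular \<open>y\<close>
  orthogonal to \<open>K\<close> but to neither \<open>h\<close> nor \<open>h'\<close> serves as an
  intermediate step.\<close>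

lemma card_sperp_hyper_same:
  assumes "generator W" "hyper A W" "hyper B W"
  shows "card (sperp A) = card (sperp B)"
proof (cases "A = B")
  case False
  note W = generatorD[OF assms(1)]
  obtain h h' where h: "h \<in> A" "h \<notin> B" "h' \<in> B" "h' \<notin> A"
    using False hyper_eqI assms by blast
  define K where "K = A \<inter> B"
  have AB: "subspace A" "subspace B" "A \<subseteq> W" "B \<subseteq> W"
    using assms by (auto simp: hyper_def)
  have hW: "h \<in> W" "h' \<in> W"
    using h AB by auto
  \<comment> \<open>This allows a choice of \<open>y\<close> orthogonal to \<open>K\<close> and
    \<open>h - h'\<close> but not to \<open>h\<close>. Orthogonality to \<open>h - h'\<close> then
    forces \<open>f h y = f h' y\<close>, so \<open>y\<close> is not orthogonal to \<open>h'\<close>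
    either.\<close>
  have "h \<notin> span (insert (h - h') K)"
  proof
    assume "h \<in> span (insert (h - h') K)"
    then obtain c where c: "h - c *s (h - h') \<in> K"
      using AB by (auto simp: span_insert K_def subspace_inter span_eq_iff[THEN iffD2])
    then have "h - c *s (h - h') \<in> A"
      by (simp add: K_def)
    then have "h - (h - c *s (h - h') + c *s h) \<in> A"
      using AB h by (metis subspace_add subspace_diff subspace_scale)
    moreover have "h - (h - c *s (h - h') + c *s h) = - (c *s h')"
      by (simp add: scale_right_diff_distrib)
    ultimately have "c *s h' \<in> A"
      using AB subspace_neg by fastforce
    then have "c = 0"
      using AB h subspace_scale[of A "c *s h'" "inverse c"] by (cases "c = 0") auto
    then show False
      using c h by (simp add: K_def)
  qed
  moreover have "span (insert (h - h') K) \<subseteq> W"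
    using W AB hW by (intro span_minimal) (auto simp: K_def subspace_diff)
  ultimately obtain y where y: "sing y" "\<And>a. a \<in> span (insert (h - h') K) \<Longrightarrow> f y a = 0"
      "f y h \<noteq> 0"
    using singular_witness[OF W(1) subspace_span _ hW(1)] by blast
  have yK: "f y s = 0" if "s \<in> K" for s
    using y that by (simp add: span_base)
  have "f y (h - h') = 0"
    using y by (simp add: span_base)
  then have "f h y = f h' y"
    using f_sym_0 f_diff by (metis right_minus_eq)
  then have nz: "f h y \<noteq> 0" "f y h' \<noteq> 0"
    using y f_sym_0 by metis+
  have "sperp A = sperp (insert h K)" "sperp B = sperp (insert h' K)"
    using hyper_decomp(1)[OF assms(1-3) h(1,2)] hyper_decomp(1)[OF assms(1,3,2) h(3,4)] sperp_span
    by (metis K_def, metis K_def inf_commute)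
  moreover have "card (sperp (insert h K)) = card (sperp (insert y K))"
    using W AB hW y yK nz by (intro card_sperp_exchange) (auto simp: K_def)
  moreover have "card (sperp (insert y K)) = card (sperp (insert h' K))"
    using W AB hW y yK nz by (intro card_sperp_exchange) (auto simp: K_def)
  ultimately show ?thesis
    by simp
qed simp

text \<open>Induction that moves \<open>W\<close> towards \<open>W'\<close>: for \<open>y\<close> in
  \<open>W'\<close> outside \<open>W\<close>, the generator \<open>W''\<close> spanned by
  \<open>y\<close> and its orthogonal hyperplane \<open>A0\<close> in \<open>W\<close> meets
  \<open>W'\<close> in a larger subspace. The hyperplane \<open>A0\<close> is common to
  \<open>W\<close> and \<open>W''\<close>, so the count carries over.\<close>

lemma card_sperp_hyper:
  assumes "generator W" "hyper A W" "generator W'" "hyper B W'"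
  shows "card (sperp A) = card (sperp B)"
  using assms
proof (induction "d - dim (W \<inter> W')" arbitrary: W A rule: less_induct)
  case less
  note W = generatorD[OF \<open>generator W\<close>] and W' = generatorD[OF \<open>generator W'\<close>]
  show ?case
  proof (cases "W' \<subseteq> W")
    case True
    then have "W' = W"
      using W W' by (intro subspace_dim_equal) auto
    then show ?thesis
      using less.prems card_sperp_hyper_same by blast
  next
    case False
    then obtain y where y: "y \<in> W'" "y \<notin> W"
      by blast
    define A0 where "A0 = {w \<in> W. f w y = 0}"
    define W'' where "W'' = span (insert y A0)"
    have A0: "hyper A0 W"
      unfolding A0_def using hyper_perp less.prems y W' by blast
    then have sub: "subspace A0" "A0 \<subseteq> W" "Suc (dim A0) = d"
      using W by (auto simp: hyper_def)
    have "totally_isotropic F A0"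
      using sub W by (auto simp: isotropic_iff subset_iff)
    then have "totally_isotropic F W''"
      unfolding W''_def using y W' by (intro isotropic_insert) (auto simp: A0_def)
    moreover have "dim W'' = d"
      using y sub dim_insert_subspace[of A0 y] by (auto simp: W''_def A0_def)
    ultimately have gen: "generator W''"
      by (simp add: generator_def)
    have sub'': "insert y A0 \<subseteq> W''"
      unfolding W''_def by (rule span_superset)
    then have hyp: "hyper A0 W''"
      using sub generatorD[OF gen] by (auto simp: hyper_def)
    \<comment> \<open>Vectors of \<open>W \<inter> W'\<close> lie in \<open>A0\<close> because
      \<open>W'\<close> is totally isotropic and contains \<open>y\<close>.\<close>
    have "insert y (W \<inter> W') \<subseteq> W'' \<inter> W'"
      using sub'' y W' by (auto simp: A0_def)
    then have "dim (insert y (W \<inter> W')) \<le> dim (W'' \<inter> W')"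
      by (rule dim_subset)
    moreover have "dim (insert y (W \<inter> W')) = Suc (dim (W \<inter> W'))"
      using y dim_insert_subspace[of "W \<inter> W'" y] W W' by (simp add: subspace_inter)
    moreover have "dim (W'' \<inter> W') \<le> d"
      using dim_subset[of "W'' \<inter> W'" W'] W' by simp
    ultimately have "d - dim (W'' \<inter> W') < d - dim (W \<inter> W')"
      by linarith
    then have "card (sperp A0) = card (sperp B)"
      using less gen hyp by blast
    then show ?thesis
      using card_sperp_hyper_same less.prems A0 by metis
  qed
qed

end

section \<open>The number of points of a projective space\<close>

definition theta :: "nat \<Rightarrow> nat \<Rightarrow> nat" where
  "theta q n = (q ^ n - 1) div (q - 1)"

text \<open>The division in \<open>theta\<close> is exact: inductively, a quotient \<open>m\<close>
  for \<open>n\<close> yields the quotient \<open>q * m + 1\<close> for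
  \<open>Suc n\<close>.\<close>

lemma theta_eq:
  assumes "q > 1"
  shows "q ^ n = (q - 1) * theta q n + 1"
proof -
  have "\<exists>m. q ^ n = (q - 1) * m + 1"
  proof (induction n)
    case (Suc n)
    then obtain m where "q ^ n = (q - 1) * m + 1"
      by blast
    then have "q ^ Suc n = (q - 1) * (q * m + 1) + 1"
      using assms by (cases q) (simp_all add: algebra_simps)
    then show ?case
      by blast
  qed auto
  then show ?thesis
    using assms by (auto simp: theta_def)
qed

lemma theta_Suc:
  assumes "q > 1"
  shows "theta q (Suc n) = q * theta q n + 1"
proof -
  have "(q - 1) * theta q (Suc n) + 1 = q * ((q - 1) * theta q n + 1)"
    using theta_eq[OF assms, of n] theta_eq[OF assms, of "Suc n"] by simp
  also have "\<dots> = (q - 1) * (q * theta q n + 1) + 1"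
    using assms by (cases q) (simp_all add: algebra_simps)
  finally have "(q - 1) * theta q (Suc n) = (q - 1) * (q * theta q n + 1)"
    by (simp only: add_right_cancel)
  moreover have "q - 1 > 0"
    using assms by simp
  ultimately show ?thesis
    by (metis mult_left_cancel less_not_refl)
qed

section \<open>Traces of points on a generator\<close>

context polar_space
begin

abbreviation points :: "'v set set" where "points \<equiv> polar_points F"

abbreviation trace :: "'v set \<Rightarrow> 'v set \<Rightarrow> 'v set set" where
  "trace W y \<equiv> perp F y \<inter> proj_points W"

abbreviation outer_adj :: "'v set \<Rightarrow> 'v set \<Rightarrow> bool" where
  "outer_adj x y \<equiv> x \<noteq> y \<and> x \<in> perp F y"

lemma card_proj_points_theta: "subspace T \<Longrightarrow> card (proj_points T) = theta q (dim T)"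
  by (simp add: card_proj_points theta_def)

text \<open>The last equation is the relation \<open>l * (v - 1) = k * (k - 1)\<close> of a
  symmetric design; by the recursion both sides equal
  \<open>q * theta q (d - 1) * theta q (d - 2)\<close>.\<close>

lemma theta_params:
  "theta q d = q * theta q (d - 1) + 1" "theta q (d - 1) = q * theta q (d - 2) + 1"
    "theta q (d - 2) > 0" "theta q (d - 1) > 1"
    "theta q (d - 2) * (theta q d - 1) = theta q (d - 1) * (theta q (d - 1) - 1)"
proof -
  obtain m where "d = 3 + m"
    using rank_ge le_Suc_ex by blast
  then have m: "d = Suc (Suc (Suc m))"
    by simp
  show 1: "theta q d = q * theta q (d - 1) + 1" "theta q (d - 1) = q * theta q (d - 2) + 1"
    using theta_Suc[OF q_gt_1] by (auto simp: m)
  show 2: "theta q (d - 2) > 0"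
    using theta_Suc[OF q_gt_1] by (simp add: m)
  then show "theta q (d - 1) > 1"
    using 1 q_gt_1 by simp
  show "theta q (d - 2) * (theta q d - 1) = theta q (d - 1) * (theta q (d - 1) - 1)"
    using 1 by (simp add: algebra_simps)
qed

lemma hyperplanes_eq: "generator W \<Longrightarrow> hyperplanes W = proj_points ` {A. hyper A W}"
  unfolding hyperplanes_def hyper_def by auto

lemma outside_iff:
  assumes "generator W"
  shows "y \<in> points - proj_points W \<longleftrightarrow> (\<exists>u. u \<noteq> 0 \<and> sing u \<and> u \<notin> W \<and> y = span {u})"
  using generatorD(2)[OF assms] span_in_proj_points[of W] by (auto simp: polar_points_iff)

lemma trace_eq:
  assumes "generator W" "u \<noteq> 0" "sing u"
  shows "trace W (span {u}) = proj_points {w \<in> W. f w u = 0}"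
proof -
  note W = generatorD[OF assms(1)]
  have "subspace {w \<in> W. f w u = 0}"
    using subspace_inter[OF W(2) subspace_f_left[of u]] by (simp add: Int_def)
  then show ?thesis
    using W assms perp_iff[of u] f_sym_0[of u] by (auto simp: proj_points_eq)
qed

lemma trace_in_hyperplanes:
  assumes "generator W" "y \<in> points - proj_points W"
  shows "trace W y \<in> hyperplanes W"
  using assms outside_iff[OF assms(1)] trace_eq hyper_perp by (auto simp: hyperplanes_eq)

text \<open>The trace is itself a hyperplane, so containing \<open>A\<close> already means being
  equal to \<open>A\<close>. Having a prescribed trace thus becomes a condition of
  orthogonality.\<close>

lemma trace_eq_hyper_iff:
  assumes "generator W" "hyper A W" "u \<noteq> 0" "sing u" "u \<notin> W"
  shows "trace W (span {u}) = proj_points A \<longleftrightarrow> u \<in> sperp A"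
proof -
  let ?H = "{w \<in> W. f w u = 0}"
  have H: "hyper ?H W"
    using assms hyper_perp by blast
  have "trace W (span {u}) = proj_points A \<longleftrightarrow> A = ?H"
    using trace_eq[OF assms(1,3,4)] proj_points_inject[of ?H A] H assms by (auto simp: hyper_def)
  also have "\<dots> \<longleftrightarrow> A \<subseteq> ?H"
    using H assms hyper_eqI by blast
  also have "\<dots> \<longleftrightarrow> u \<in> sperp A"
    using assms f_sym_0[of u] by (auto simp: sperp_def hyper_def)
  finally show ?thesis .
qed

text \<open>The points in question are represented by the vectors of \<open>sperp A - W\<close>, a
  set closed under nonzero scaling.\<close>

lemma card_points_with_trace:
  assumes "generator W" "hyper A W"
  shows "(q - 1) * card {y \<in> points - proj_points W. trace W y = proj_points A} = card (sperp A - W)"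
proof -
  note W = generatorD[OF assms(1)]
  have "{y \<in> points - proj_points W. trace W y = proj_points A} = (\<lambda>u. span {u}) ` (sperp A - W)"
  proof (intro equalityI subsetI)
    fix y
    assume y: "y \<in> {y \<in> points - proj_points W. trace W y = proj_points A}"
    then obtain u where u: "u \<noteq> 0" "sing u" "u \<notin> W" "y = span {u}"
      using outside_iff[OF assms(1)] by blast
    then have "u \<in> sperp A"
      using y trace_eq_hyper_iff[OF assms] by auto
    then show "y \<in> (\<lambda>u. span {u}) ` (sperp A - W)"
      using u by auto
  next
    fix y
    assume "y \<in> (\<lambda>u. span {u}) ` (sperp A - W)"
    then obtain u where u: "u \<in> sperp A" "u \<notin> W" "y = span {u}"
      by auto
    then have "sing u" "u \<noteq> 0"
      using W by (auto simp: sperp_def subspace_0)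
    then show "y \<in> {y \<in> points - proj_points W. trace W y = proj_points A}"
      using u outside_iff[OF assms(1), of y] trace_eq_hyper_iff[OF assms] by auto
  qed
  moreover have "card (sperp A - W) = (q - 1) * card ((\<lambda>u. span {u}) ` (sperp A - W))"
  proof (rule card_points_of_cone)
    show "0 \<notin> sperp A - W"
      using W by (simp add: subspace_0)
    show "c *s v \<in> sperp A - W" if "c \<noteq> 0" "v \<in> sperp A - W" for c v
      using that W subspace_scale[of W "c *s v" "inverse c"] by (auto simp: sperp_def f_scale sing_scale)
  qed
  ultimately show ?thesis
    by simp
qed

text \<open>Collinearity with \<open>y = span {x}\<close> adds the condition
  \<open>f z x = 0\<close>. As the traces differ, some \<open>h\<close> in \<open>A\<close> is not
  orthogonal to \<open>x\<close>, and translations by multiples of \<open>h\<close> show that this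
  condition divides the count by \<open>q\<close>. Different traces also rule out
  \<open>z = y\<close>.\<close>

lemma card_neighbours_with_trace:
  assumes "generator W" "hyper A W" "y \<in> points - proj_points W" "trace W y \<noteq> proj_points A"
  shows "(q - 1) * (q * card {z \<in> points - proj_points W. outer_adj y z \<and> trace W z = proj_points A})
    = card (sperp A - W)"
proof -
  note W = generatorD[OF assms(1)]
  obtain x where x: "x \<noteq> 0" "sing x" "x \<notin> W" "y = span {x}"
    using outside_iff assms by blast
  have A: "A \<subseteq> W" "subspace A"
    using assms by (auto simp: hyper_def)
  have "x \<notin> sperp A"
    using trace_eq_hyper_iff assms x by blast
  then obtain h where h: "h \<in> A" "f h x \<noteq> 0"
    using x f_sym_0 by (auto simp: sperp_def)
  let ?S = "{z \<in> sperp A - W. f z x = 0}"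
  have "{z \<in> points - proj_points W. outer_adj y z \<and> trace W z = proj_points A}
      = (\<lambda>u. span {u}) ` ?S"
  proof (intro equalityI subsetI)
    fix z
    assume z: "z \<in> {z \<in> points - proj_points W. outer_adj y z \<and> trace W z = proj_points A}"
    then obtain u where u: "u \<noteq> 0" "sing u" "u \<notin> W" "z = span {u}"
      using outside_iff[OF assms(1)] by blast
    then have "u \<in> sperp A" "f u x = 0"
      using z x trace_eq_hyper_iff[OF assms(1,2)] perp_iff[of u x] by auto
    then show "z \<in> (\<lambda>u. span {u}) ` ?S"
      using u by auto
  next
    fix z
    assume "z \<in> (\<lambda>u. span {u}) ` ?S"
    then obtain u where u: "u \<in> sperp A" "u \<notin> W" "f u x = 0" "z = span {u}"
      by auto
    then have "sing u" "u \<noteq> 0"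
      using W by (auto simp: sperp_def subspace_0)
    moreover from this have "trace W z = proj_points A"
      using u trace_eq_hyper_iff[OF assms(1,2)] by auto
    ultimately show "z \<in> {z \<in> points - proj_points W. outer_adj y z \<and> trace W z = proj_points A}"
      using u x assms(4) outside_iff[OF assms(1), of z] perp_iff[of u x] by auto
  qed
  moreover have "card ?S = (q - 1) * card ((\<lambda>u. span {u}) ` ?S)"
  proof (rule card_points_of_cone)
    show "0 \<notin> ?S"
      using W by (simp add: subspace_0)
    show "c *s v \<in> ?S" if "c \<noteq> 0" "v \<in> ?S" for c v
      using that W subspace_scale[of W "c *s v" "inverse c"] by (auto simp: sperp_def f_scale sing_scale)
  qed
  moreover have "card (sperp A - W) = q * card ?S"
  proof (rule card_translation_closed[of _ h])
    show "z + c *s h \<in> sperp A - W" if "z \<in> sperp A - W" for z c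
    proof -
      have "z + c *s h \<in> sperp A"
        using that h A W by (intro sperp_add_scale) (auto simp: subset_iff)
      \<comment> \<open>A translate by a vector of \<open>W\<close> cannot enter \<open>W\<close>
        from outside.\<close>
      moreover have "z + c *s h - c *s h \<in> W" if "z + c *s h \<in> W"
        using that h A W by (intro subspace_diff subspace_scale) auto
      ultimately show ?thesis
        using that by auto
    qed
  qed (use h in auto)
  ultimately show ?thesis
    by simp
qed

section \<open>Fibre sizes common to all generators\<close>

lemma sperp_minus_generator_nonempty:
  assumes "generator W" "hyper A W"
  shows "sperp A - W \<noteq> {}"
proof -
  note W = generatorD[OF assms(1)]
  have A: "subspace A" "A \<subseteq> W" "Suc (dim A) = d"
    using assms W by (auto simp: hyper_def)
  then have "\<not> W \<subseteq> A"
    using W dim_subset[of W A] by auto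
  then obtain x where x: "x \<in> W" "x \<notin> A"
    by blast
  obtain y where "sing y" "\<And>a. a \<in> A \<Longrightarrow> f y a = 0" "f y x \<noteq> 0"
    using singular_witness[OF W(1) A(1,2) x] by blast
  then show ?thesis
    using W x by (auto simp: sperp_def)
qed

lemma exists_hyper:
  assumes "generator W"
  obtains A where "hyper A W"
proof -
  note W = generatorD[OF assms]
  have "\<not> W \<subseteq> {0}"
    using W(3) rank_ge dim_eq_0[of W] by simp
  then obtain x where x: "x \<in> W" "x \<noteq> 0"
    by auto
  have "{0} \<subseteq> W" "x \<notin> {0}"
    using x W(2) by (simp_all add: subspace_0)
  then obtain y where y: "sing y" "f y x \<noteq> 0"
    by (metis singular_witness[OF W(1) subspace_single_0 _ x(1)])
  then have "y \<notin> W"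
    using W(5) x(1) by auto
  then show ?thesis
    using that hyper_perp[OF assms y(1)] by blast
qed

text \<open>One pair \<open>N\<close>, \<open>b\<close> serves all generators, so that counts made
  with different generators can be compared. Both numbers are quotients of the common size
  \<open>M\<close> of the sets \<open>sperp A - W\<close>.\<close>

lemma projection_graph_constants:
  obtains N b where "N > 0" and "\<And>W. generator W \<Longrightarrow>
    projection_graph points (proj_points W) (hyperplanes W) (trace W) outer_adj N b"
proof -
  \<comment> \<open>The zero subspace is totally isotropic and extends to a generator.\<close>
  obtain W0 where W0: "generator W0"
    using isotropic_span[of "{}"] generator_extension by blast
  obtain A0 where A0: "hyper A0 W0"
    using exists_hyper W0 by blast
  \<comment> \<open>A generator \<open>W\<close> has \<open>q ^ d\<close> vectors and lies in
    \<open>sperp A\<close>, so by \<open>card_sperp_hyper\<close> this is the size of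
    \<open>sperp A - W\<close> for every choice of \<open>W\<close> and \<open>A\<close>.\<close>
  define M where "M = card (sperp A0) - q ^ d"
  have card: "card (sperp A - W) = M" if "generator W" "hyper A W" for W A
  proof -
    note W = generatorD[OF \<open>generator W\<close>]
    have "W \<subseteq> sperp A"
      using W that by (auto simp: sperp_def hyper_def)
    then show ?thesis
      using card_sperp_hyper[OF that W0 A0] W card_subspace finite_vectors
      by (simp add: card_Diff_subset M_def)
  qed
  have "M > 0"
    using card[OF W0 A0] sperp_minus_generator_nonempty[OF W0 A0] finite_vectors card_gt_0_iff[of "sperp A0 - W0"]
    by simp
  define N where "N = M div (q - 1)"
  define b where "b = N div q"
  have N: "c = N" if "(q - 1) * c = M" for c
    unfolding N_def that[symmetric] using q_gt_1 by simp
  have fibre: "card {y \<in> points - proj_points W. trace W y = H} = N"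
    if prem: "generator W" "H \<in> hyperplanes W" for W H
  proof -
    obtain A where A: "hyper A W" "H = proj_points A"
      using prem by (auto simp: hyperplanes_eq)
    let ?c = "card {y \<in> points - proj_points W. trace W y = H}"
    have "(q - 1) * ?c = M"
      unfolding A(2) using card_points_with_trace[of W A] card[of W A] prem(1) A(1) by simp
    then show ?thesis
      by (rule N)
  qed
  have neighbours: "card {z \<in> points - proj_points W. outer_adj y z \<and> trace W z = H} = b"
    if prem: "generator W" "y \<in> points - proj_points W" "H \<in> hyperplanes W" "H \<noteq> trace W y"
    for W H y
  proof -
    obtain A where A: "hyper A W" "H = proj_points A"
      using prem by (auto simp: hyperplanes_eq)
    let ?c = "card {z \<in> points - proj_points W. outer_adj y z \<and> trace W z = H}"
    have "(q - 1) * (q * ?c) = M"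
      unfolding A(2)
      using card_neighbours_with_trace[of W A y] card[of W A] prem(1,2,4) A by simp
    then have "q * ?c = N"
      by (rule N)
    then have "N div q = q * ?c div q"
      by (rule arg_cong[OF sym])
    then show ?thesis
      using q_gt_1 by (simp only: b_def) simp
  qed
  \<comment> \<open>One fibre suffices to see that \<open>q - 1\<close> divides \<open>M\<close>, so
    \<open>N\<close> inherits positivity from \<open>M\<close>.\<close>
  have "(q - 1) * N = M"
    using card_points_with_trace[OF W0 A0] card[OF W0 A0] N by simp
  then have "N > 0"
    using \<open>M > 0\<close> by (cases N) auto
  moreover have "projection_graph points (proj_points W) (hyperplanes W) (trace W) outer_adj N b"
    if "generator W" for W
  proof
    show "finite points"
      by (rule finite_points)
    show "proj_points W \<subseteq> points"
      using that generatorD proj_points_isotropic by blast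
    show "finite (hyperplanes W)"
      unfolding hyperplanes_eq[OF that] by (intro finite_imageI finite_points)
    show "trace W y \<in> hyperplanes W" if "y \<in> points - proj_points W" for y
      using \<open>generator W\<close> that by (rule trace_in_hyperplanes)
    show "card {y \<in> points - proj_points W. trace W y = H} = N" if "H \<in> hyperplanes W" for H
      using \<open>generator W\<close> that by (rule fibre)
    show "card {z \<in> points - proj_points W. outer_adj y z \<and> trace W z = H} = b"
      if "y \<in> points - proj_points W" "H \<in> hyperplanes W" "H \<noteq> trace W y" for y H
      using \<open>generator W\<close> that by (rule neighbours)
  qed
  ultimately show ?thesis
    using that by blast
qed

section \<open>Collinearity and generators\<close>

lemma perp_commute: "x \<in> points \<Longrightarrow> y \<in> points \<Longrightarrow> x \<in> perp F y \<longleftrightarrow> y \<in> perp F x"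
  by (auto simp: perp_def collinear_points_def)

lemma collinearity_adj_iff: "x \<in> points \<Longrightarrow> y \<in> points \<Longrightarrow> collinearity_adj F x y \<longleftrightarrow> outer_adj x y"
  by (auto simp: perp_def collinearity_adj_def collinear_points_def)

lemma perp_in_generator:
  assumes "generator W" "x \<in> proj_points W" "y \<in> proj_points W"
  shows "x \<in> perp F y"
proof -
  note W = generatorD[OF assms(1)]
  obtain u v where "u \<noteq> 0" "u \<in> W" "x = span {u}" "v \<noteq> 0" "v \<in> W" "y = span {v}"
    using assms(2,3) W(2) by (auto simp: proj_points_eq)
  then show ?thesis
    using perp_iff[of v u] W(4,5) by simp
qed

lemma generator_of_point:
  assumes "x \<in> points"
  obtains W where "generator W" "x \<in> proj_points W"
proof -
  obtain W where "generator W" "x \<subseteq> W"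
    using generator_extension[of x] assms by (auto simp: polar_points_def)
  then show ?thesis
    using that assms by (auto simp: proj_points_def polar_points_def isotropic_iff)
qed

lemma generator_of_collinear_points:
  assumes "collinearity_adj F x y"
  obtains W where "generator W" "x \<in> proj_points W" "y \<in> proj_points W"
proof -
  obtain L where L: "totally_isotropic F L" "x \<subseteq> L" "y \<subseteq> L" and xy: "x \<in> points" "y \<in> points"
    using assms by (auto simp: collinearity_adj_def collinear_points_def polar_lines_def)
  obtain W where "generator W" "L \<subseteq> W"
    using generator_extension L by blast
  then show ?thesis
    using that L xy by (auto simp: proj_points_def polar_points_def isotropic_iff)
qed

section \<open>Hyperplanes and design blocks as block systems\<close>

lemma card_hyperplane:
  assumes "generator W" "H \<in> hyperplanes W"
  shows "H \<subseteq> proj_points W" "card H = theta q (d - 1)"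
proof -
  obtain A where A: "hyper A W" "H = proj_points A"
    using assms by (auto simp: hyperplanes_eq)
  then have "dim A = d - 1"
    using generatorD(3)[OF assms(1)] by (auto simp: hyper_def)
  then show "card H = theta q (d - 1)"
    using A by (simp add: card_proj_points_theta hyper_def)
  show "H \<subseteq> proj_points W"
    using A by (auto simp: proj_points_def hyper_def)
qed

lemma card_hyperplane_Int:
  assumes "generator W" "H \<in> hyperplanes W" "H' \<in> hyperplanes W" "H \<noteq> H'"
  shows "card (H \<inter> H') = theta q (d - 2)"
proof -
  obtain A B where A: "hyper A W" "H = proj_points A" and B: "hyper B W" "H' = proj_points B"
    using assms by (auto simp: hyperplanes_eq)
  then obtain h where "h \<in> A" "h \<notin> B"
    using assms(4) hyper_eqI by blast
  then have "Suc (dim (A \<inter> B)) = dim A"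
    using hyper_decomp(2)[OF assms(1)] A(1) B(1) by blast
  then have "dim (A \<inter> B) = d - 2"
    using A generatorD(3)[OF assms(1)] by (auto simp: hyper_def)
  moreover have "subspace (A \<inter> B)"
    using A B by (auto simp: hyper_def subspace_inter)
  ultimately show ?thesis
    using A B by (simp add: proj_points_Int card_proj_points_theta)
qed

lemma card_generator_points: "generator W \<Longrightarrow> card (proj_points W) = theta q d"
  using card_proj_points_theta generatorD(2,3) by simp

text \<open>Here the hyperplanes play the role of rows: their sizes and pairwise intersections are
  known from dimensions, and the numbers through points follow by
  \<open>replication_of_pairs\<close> and \<open>dual_pairs\<close>. The number of hyperplanes is an
  assumption; it will be read off from the bijection with the blocks.\<close>

lemma hyperplane_block_system:
  assumes "generator W" "card (hyperplanes W) = theta q d"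
    and "projection_graph points (proj_points W) (hyperplanes W) (trace W) outer_adj N b"
  shows "projection_graph.block_system (proj_points W) (hyperplanes W) (\<lambda>H. H)
    (theta q (d - 1)) (theta q (d - 2))"
proof -
  interpret G: projection_graph points "proj_points W" "hyperplanes W" "trace W" outer_adj N b
    by (rule assms(3))
  have set_eq: "{x \<in> proj_points W. x \<in> H} = H" if "H \<in> hyperplanes W" for H
    using card_hyperplane(1)[OF assms(1) that] by auto
  have row: "card {x \<in> proj_points W. x \<in> H} = theta q (d - 1)" if "H \<in> hyperplanes W" for H
    using card_hyperplane[OF assms(1) that] set_eq[OF that] by simp
  have pairs: "card {x \<in> proj_points W. x \<in> H \<and> x \<in> H'} = theta q (d - 2)"
    if "H \<in> hyperplanes W" "H' \<in> hyperplanes W" "H \<noteq> H'" for H H'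
  proof -
    have "{x \<in> proj_points W. x \<in> H \<and> x \<in> H'} = H \<inter> H'"
      using card_hyperplane(1)[OF assms(1) that(1)] by auto
    then show ?thesis
      using card_hyperplane_Int[OF assms(1) that] by simp
  qed
  have column: "card {H \<in> hyperplanes W. x \<in> H} = theta q (d - 1)" if "x \<in> proj_points W" for x
    using replication_of_pairs[of "hyperplanes W" "proj_points W" "\<lambda>H x. x \<in> H",
        OF G.finite_H G.finite_U row pairs assms(2) card_generator_points[OF assms(1)]
          theta_params(5) that]
    by simp
  have row_pairs: "card {H \<in> hyperplanes W. x \<in> H \<and> y \<in> H} = theta q (d - 2)"
    if "x \<in> proj_points W" "y \<in> proj_points W" "x \<noteq> y" for x y
    using dual_pairs[of "hyperplanes W" "proj_points W" "\<lambda>H x. x \<in> H",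
        OF G.finite_H G.finite_U row column pairs card_generator_points[OF assms(1)]
          theta_params(5) that]
    by simp
  show ?thesis
    unfolding G.block_system_def
    by (intro conjI ballI impI)
      (simp_all add: card_hyperplane[OF assms(1)] card_hyperplane_Int[OF assms(1)] column row_pairs)
qed

text \<open>The design is pulled back along \<open>\<phi>\<close> and the points play the role of
  rows. The replication number comes from \<open>replication_of_2_design\<close>, the intersections
  of blocks from \<open>dual_pairs\<close>.\<close>

lemma design_block_system:
  assumes "generator W"
    and "symmetric_design (proj_points W) \<B> (theta q d) (theta q (d - 1)) (theta q (d - 2))"
    and \<phi>: "bij_betw \<phi> (hyperplanes W) \<B>"
    and "projection_graph points (proj_points W) (hyperplanes W) (trace W) outer_adj N b"
  shows "projection_graph.block_system (proj_points W) (hyperplanes W) \<phi>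
    (theta q (d - 1)) (theta q (d - 2))"
proof -
  interpret G: projection_graph points "proj_points W" "hyperplanes W" "trace W" outer_adj N b
    by (rule assms(4))
  have D: "\<And>B. B \<in> \<B> \<Longrightarrow> B \<subseteq> proj_points W \<and> card B = theta q (d - 1)"
    "\<And>x y. x \<in> proj_points W \<Longrightarrow> y \<in> proj_points W \<Longrightarrow> x \<noteq> y \<Longrightarrow>
      card {B \<in> \<B>. x \<in> B \<and> y \<in> B} = theta q (d - 2)"
    "card \<B> = theta q d"
    using assms(2) by (auto simp: symmetric_design_def)
  have block: "\<phi> H \<subseteq> proj_points W \<and> card (\<phi> H) = theta q (d - 1)" if "H \<in> hyperplanes W" for H
    using D(1) bij_betwE[OF \<phi>] that by blast
  have column: "card {x \<in> proj_points W. x \<in> \<phi> H} = theta q (d - 1)" if "H \<in> hyperplanes W" for H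
  proof -
    have "{x \<in> proj_points W. x \<in> \<phi> H} = \<phi> H"
      using block[OF that] by auto
    then show ?thesis
      using block[OF that] by simp
  qed
  have pairs: "card {H \<in> hyperplanes W. x \<in> \<phi> H \<and> y \<in> \<phi> H} = theta q (d - 2)"
    if "x \<in> proj_points W" "y \<in> proj_points W" "x \<noteq> y" for x y
  proof -
    have "{B \<in> \<B>. x \<in> B \<and> y \<in> B} = \<phi> ` {H \<in> hyperplanes W. x \<in> \<phi> H \<and> y \<in> \<phi> H}"
      using bij_betw_imp_surj_on[OF \<phi>] by auto
    moreover have "inj_on \<phi> {H \<in> hyperplanes W. x \<in> \<phi> H \<and> y \<in> \<phi> H}"
      using bij_betw_imp_inj_on[OF \<phi>] by (rule inj_on_subset) auto
    ultimately show ?thesis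
      using D(2)[OF that] by (simp add: card_image)
  qed
  have row: "card {H \<in> hyperplanes W. x \<in> \<phi> H} = theta q (d - 1)" if "x \<in> proj_points W" for x
    using replication_of_2_design[of "proj_points W" "hyperplanes W" "\<lambda>x H. x \<in> \<phi> H",
        OF G.finite_U G.finite_H column pairs card_generator_points[OF assms(1)]
          theta_params(5,4) that]
    by simp
  have card_H: "card (hyperplanes W) = theta q d"
    using bij_betw_same_card[OF \<phi>] D(3) by simp
  have column_pairs: "card (\<phi> H \<inter> \<phi> H') = theta q (d - 2)"
    if H: "H \<in> hyperplanes W" "H' \<in> hyperplanes W" "H \<noteq> H'" for H H'
  proof -
    have "\<phi> H \<inter> \<phi> H' = {x \<in> proj_points W. x \<in> \<phi> H \<and> x \<in> \<phi> H'}"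
      using block[OF H(1)] by auto
    then show ?thesis
      using dual_pairs[of "proj_points W" "hyperplanes W" "\<lambda>x H. x \<in> \<phi> H",
          OF G.finite_U G.finite_H row column pairs card_H theta_params(5) H]
      by simp
  qed
  show ?thesis
    unfolding G.block_system_def
    by (intro conjI ballI impI) (simp_all add: block row pairs column_pairs)
qed

section \<open>Strong regularity of both graphs\<close>

theorem strongly_regular_modification:
  assumes W: "generator W"
    and design: "symmetric_design (proj_points W) \<B>
      (theta q d) (theta q (d - 1)) (theta q (d - 2))"
    and \<phi>: "bij_betw \<phi> (hyperplanes W) \<B>"
  shows "\<exists>v k l m. strongly_regular points (collinearity_adj F) v k l m \<and>
    strongly_regular points (modified_adj F (proj_points W) \<phi>) v k l m"
proof -
  obtain N b where "N > 0" and graph: "\<And>W. generator W \<Longrightarrow>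
      projection_graph points (proj_points W) (hyperplanes W) (trace W) outer_adj N b"
    using projection_graph_constants by blast
  interpret G: projection_graph points "proj_points W" "hyperplanes W" "trace W" outer_adj N b
    by (rule graph[OF W])
  \<comment> \<open>Two expressions for the number of outer points. The second is the same for all
    generators, so after cancelling \<open>N > 0\<close> the number of hyperplanes, known for
    \<open>W\<close> through \<open>\<phi>\<close>, carries over to every generator.\<close>
  have card_outside: "card (points - proj_points W') = card (hyperplanes W') * N"
    and card_inside: "card (points - proj_points W') = card points - theta q d"
    if "generator W'" for W'
  proof -
    interpret G': projection_graph points "proj_points W'" "hyperplanes W'" "trace W'" outer_adj N b
      by (rule graph[OF that])
    show "card (points - proj_points W') = card (hyperplanes W') * N"
      using G'.card_outside_all[of "\<lambda>_. True"] by (simp add: set_diff_eq)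
    show "card (points - proj_points W') = card points - theta q d"
      using G'.U_sub G'.finite_U card_generator_points[OF that] by (simp add: card_Diff_subset)
  qed
  have card_W: "card (hyperplanes W) = theta q d"
    using bij_betw_same_card[OF \<phi>] design by (auto simp: symmetric_design_def)
  have card_H: "card (hyperplanes W') = theta q d" if "generator W'" for W'
    using card_outside[OF that] card_inside[OF that] card_outside[OF W] card_inside[OF W] card_W
      \<open>N > 0\<close> by simp

  \<comment> \<open>The values of \<open>degree_inside\<close>, of \<open>common_inside\<close> and
    of the non-incident case of \<open>common_mixed\<close> for the parameters at hand.\<close>
  define k0 where "k0 = (theta q d - 1) + theta q (d - 1) * N"
  define l0 where "l0 = (theta q d - 2) + theta q (d - 2) * N"
  define m0 where "m0 = theta q (d - 1) + theta q (d - 1) * b"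

  \<comment> \<open>The collinearity graph is the case of the identity map with respect to every
    generator, so the generator may be adapted to the vertices considered.\<close>
  have adj_eq: "collinearity_adj F x y \<longleftrightarrow>
      projection_graph.adj (proj_points W') (trace W') outer_adj (\<lambda>H. H) x y"
    if "generator W'" "x \<in> points" "y \<in> points" for W' x y
  proof -
    interpret G': projection_graph points "proj_points W'" "hyperplanes W'" "trace W'" outer_adj N b
      by (rule graph[OF that(1)])
    show ?thesis
      using collinearity_adj_iff[OF that(2,3)] perp_in_generator[OF that(1)]
        perp_commute[OF that(2,3)] by (auto simp: G'.adj_def)
  qed
  have blocks: "projection_graph.block_system (proj_points W') (hyperplanes W') (\<lambda>H. H)
      (theta q (d - 1)) (theta q (d - 2))" if "generator W'" for W'
    using hyperplane_block_system[OF that card_H graph] that by blast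

  have deg0: "card {z \<in> points. collinearity_adj F x z} = k0" if x: "x \<in> points" for x
  proof -
    obtain W' where W': "generator W'" "x \<in> proj_points W'"
      using generator_of_point x by blast
    interpret G': projection_graph points "proj_points W'" "hyperplanes W'" "trace W'" outer_adj N b
      by (rule graph[OF W'(1)])
    have "{z \<in> points. collinearity_adj F x z} = {z \<in> points. G'.adj (\<lambda>H. H) x z}"
      using adj_eq[OF W'(1) x] by blast
    then show ?thesis
      using G'.degree_inside[OF blocks[OF W'(1)] W'(2)] card_generator_points[OF W'(1)]
      by (simp add: k0_def)
  qed
  have common_adj0: "card {z \<in> points. collinearity_adj F x z \<and> collinearity_adj F y z} = l0"
    if xy: "x \<in> points" "y \<in> points" "collinearity_adj F x y" for x y
  proof -
    obtain W' where W': "generator W'" "x \<in> proj_points W'" "y \<in> proj_points W'"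
      using generator_of_collinear_points xy by blast
    interpret G': projection_graph points "proj_points W'" "hyperplanes W'" "trace W'" outer_adj N b
      by (rule graph[OF W'(1)])
    have "{z \<in> points. collinearity_adj F x z \<and> collinearity_adj F y z}
        = {z \<in> points. G'.adj (\<lambda>H. H) x z \<and> G'.adj (\<lambda>H. H) y z}"
      using adj_eq[OF W'(1) xy(1)] adj_eq[OF W'(1) xy(2)] by blast
    moreover have "x \<noteq> y"
      using xy by (simp add: collinearity_adj_def)
    ultimately show ?thesis
      using G'.common_inside[OF blocks[OF W'(1)] W'(2,3)] card_generator_points[OF W'(1)]
      by (simp add: l0_def)
  qed
  have common_nonadj0: "card {z \<in> points. collinearity_adj F x z \<and> collinearity_adj F y z} = m0"
    if xy: "x \<in> points" "y \<in> points" "x \<noteq> y" "\<not> collinearity_adj F x y" for x y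
  proof -
    obtain W' where W': "generator W'" "x \<in> proj_points W'"
      using generator_of_point xy by blast
    interpret G': projection_graph points "proj_points W'" "hyperplanes W'" "trace W'" outer_adj N b
      by (rule graph[OF W'(1)])
    have eq: "{z \<in> points. collinearity_adj F x z \<and> collinearity_adj F y z}
        = {z \<in> points. G'.adj (\<lambda>H. H) x z \<and> G'.adj (\<lambda>H. H) y z}"
      using adj_eq[OF W'(1) xy(1)] adj_eq[OF W'(1) xy(2)] by blast
    \<comment> \<open>Non-collinearity puts \<open>y\<close> outside the generator through
      \<open>x\<close> and \<open>x\<close> outside the trace of \<open>y\<close>, which is the
      second case of \<open>common_mixed\<close>.\<close>
    have x: "x \<notin> perp F y"
      using xy collinearity_adj_iff by blast
    then have y: "y \<in> points - proj_points W'"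
      using xy(2) W' perp_in_generator by blast
    show ?thesis
      unfolding eq G'.common_mixed[OF blocks[OF W'(1)] W'(2) y] using x by (simp add: m0_def)
  qed

  have \<phi>_blocks: "G.block_system \<phi> (theta q (d - 1)) (theta q (d - 2))"
    using design_block_system[OF W design \<phi> graph[OF W]] .
  have modified_eq: "modified_adj F (proj_points W) \<phi> x y \<longleftrightarrow> G.adj \<phi> x y" for x y
    by (auto simp: modified_adj_def G.adj_def)
  have outside: "{z \<in> points. collinearity_adj F x z} = {z \<in> points. G.adj (\<lambda>H. H) x z}"
    "{z \<in> points. collinearity_adj F x z \<and> collinearity_adj F y z}
      = {z \<in> points. G.adj (\<lambda>H. H) x z \<and> G.adj (\<lambda>H. H) y z}"
    if "x \<in> points" "y \<in> points" for x y
    using adj_eq[OF W that(1)] adj_eq[OF W that(2)] by auto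

  have deg: "card {z \<in> points. G.adj \<phi> x z} = k0" if x: "x \<in> points" for x
  proof (cases "x \<in> proj_points W")
    case True
    then show ?thesis
      using G.degree_inside[OF \<phi>_blocks] card_generator_points[OF W] by (simp add: k0_def)
  next
    case False
    then have "x \<in> points - proj_points W"
      using x by simp
    then show ?thesis
      \<comment> \<open>For an outer point the degree formula is the same for \<open>\<phi>\<close>
        and for the identity, so the known degree in the collinearity graph applies.\<close>
      using G.degree_outside[OF \<phi>_blocks] G.degree_outside[OF blocks[OF W]] deg0[OF x]
        outside(1)[OF x x] by simp
  qed
  have mixed: "card {z \<in> points. G.adj \<phi> x z \<and> G.adj \<phi> y z}
      = (if x \<in> \<phi> (trace W y) then l0 else m0)"
    if xy: "x \<in> proj_points W" "y \<in> points - proj_points W" for x y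
  proof (cases "x \<in> \<phi> (trace W y)")
    case True
    \<comment> \<open>The term left open in \<open>common_mixed\<close> is evaluated by comparison:
      a point \<open>x0\<close> in the trace of \<open>y\<close> is collinear with \<open>y\<close>,
      so in the collinearity graph the same expression counts \<open>l0\<close> common
      neighbours.\<close>
    have "card (trace W y) = theta q (d - 1)"
      using card_hyperplane W trace_in_hyperplanes[OF W xy(2)] by blast
    then have "trace W y \<noteq> {}"
      using theta_params(4) by auto
    then obtain x0 where x0: "x0 \<in> trace W y"
      by auto
    then have x0': "x0 \<in> proj_points W" "x0 \<in> points" "y \<in> points"
      using G.U_sub xy(2) by auto
    have "x0 \<noteq> y"
      using x0' xy by auto
    then have "collinearity_adj F x0 y"
      using collinearity_adj_iff[OF x0'(2,3)] x0 by simp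
    then have "l0 = card {z \<in> points. G.adj (\<lambda>H. H) x0 z \<and> G.adj (\<lambda>H. H) y z}"
      using common_adj0[OF x0'(2,3)] outside(2)[OF x0'(2,3)] by simp
    then show ?thesis
      using G.common_mixed[OF \<phi>_blocks xy] G.common_mixed[OF blocks[OF W] x0'(1) xy(2)] True x0
      by simp
  next
    case False
    then show ?thesis
      using G.common_mixed[OF \<phi>_blocks xy] by (simp add: m0_def)
  qed
  have common: "card {z \<in> points. G.adj \<phi> x z \<and> G.adj \<phi> y z} = (if G.adj \<phi> x y then l0 else m0)"
    if xy: "x \<in> points" "y \<in> points" "x \<noteq> y" for x y
  proof (cases "x \<in> proj_points W"; cases "y \<in> proj_points W")
    assume U: "x \<in> proj_points W" "y \<in> proj_points W"
    then show ?thesis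
      using G.common_inside[OF \<phi>_blocks U xy(3)] card_generator_points[OF W] xy(3)
      by (simp add: l0_def G.adj_def)
  next
    assume U: "x \<in> proj_points W" "y \<notin> proj_points W"
    then show ?thesis
      using mixed[of x y] xy by (simp add: G.adj_def)
  next
    assume U: "x \<notin> proj_points W" "y \<in> proj_points W"
    have "{z \<in> points. G.adj \<phi> x z \<and> G.adj \<phi> y z} = {z \<in> points. G.adj \<phi> y z \<and> G.adj \<phi> x z}"
      by blast
    then show ?thesis
      using mixed[of y x] xy U by (simp add: G.adj_def)
  next
    assume U: "x \<notin> proj_points W" "y \<notin> proj_points W"
    then have "x \<in> points - proj_points W" "y \<in> points - proj_points W"
      using xy by auto
    \<comment> \<open>For two outer points neither the adjacency nor the number of common neighbours
      depends on the block system.\<close>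
    then have "card {z \<in> points. G.adj \<phi> x z \<and> G.adj \<phi> y z}
        = card {z \<in> points. collinearity_adj F x z \<and> collinearity_adj F y z}"
      using G.common_outside[OF \<phi>_blocks] G.common_outside[OF blocks[OF W]] outside(2)[OF xy(1,2)]
      by simp
    moreover have "G.adj \<phi> x y \<longleftrightarrow> collinearity_adj F x y"
      using U collinearity_adj_iff[OF xy(1,2)] by (simp add: G.adj_def)
    ultimately show ?thesis
      using common_adj0 common_nonadj0 xy by simp
  qed

  have witnesses: "(\<exists>x\<in>points. \<exists>y\<in>points. x \<noteq> y \<and> \<not> G.adj \<psi> x y)"
    "(\<exists>x\<in>points. \<exists>y\<in>points. G.adj \<psi> x y)"
    if \<psi>: "G.block_system \<psi> (theta q (d - 1)) (theta q (d - 2))" for \<psi>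
  proof -
    \<comment> \<open>Blocks are proper subsets of the generator, so an outer point, which exists
      because \<open>N > 0\<close>, has a non-neighbour in the generator.\<close>
    have "theta q (d - 1) \<le> q * theta q (d - 1)"
      using q_gt_1 by simp
    then have v: "theta q d > theta q (d - 1)" "theta q d > 1"
      using theta_params(1,4) by linarith+
    have "card (points - proj_points W) > 0"
      using card_outside[OF W] card_W v(2) \<open>N > 0\<close> by simp
    then have "points - proj_points W \<noteq> {}"
      by (simp only: card_gt_0_iff simp_thms)
    then obtain y where y: "y \<in> points - proj_points W"
      by auto
    have "card (\<psi> (trace W y)) < card (proj_points W)"
      using \<psi> trace_in_hyperplanes[OF W y] card_generator_points[OF W] v(1)
      by (simp add: G.block_system_def)
    moreover have "card (proj_points W) \<le> card (\<psi> (trace W y))" if "proj_points W \<subseteq> \<psi> (trace W y)"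
      using that \<psi> trace_in_hyperplanes[OF W y] G.finite_U
      by (intro card_mono) (auto simp: G.block_system_def intro: finite_subset)
    ultimately obtain x where x: "x \<in> proj_points W" "x \<notin> \<psi> (trace W y)"
      by force
    then have "x \<noteq> y" "\<not> G.adj \<psi> x y" "x \<in> points" "y \<in> points"
      using y G.U_sub by (auto simp: G.adj_def)
    then show "\<exists>x\<in>points. \<exists>y\<in>points. x \<noteq> y \<and> \<not> G.adj \<psi> x y"
      by blast
    have "proj_points W \<noteq> {x}"
      using card_generator_points[OF W] v(2) by auto
    then obtain x' where "x' \<in> proj_points W" "x' \<noteq> x"
      using x(1) by blast
    then have "G.adj \<psi> x x'" "x \<in> points" "x' \<in> points"
      using x(1) G.U_sub by (auto simp: G.adj_def)
    then show "\<exists>x\<in>points. \<exists>y\<in>points. G.adj \<psi> x y"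
      by blast
  qed

  have "strongly_regular points (collinearity_adj F) (card points) k0 l0 m0"
    unfolding strongly_regular_def
  proof (intro conjI)
    show "symp_on points (collinearity_adj F)"
    proof (rule symp_onI)
      show "collinearity_adj F y x" if "x \<in> points" "y \<in> points" "collinearity_adj F x y" for x y
      proof -
        have "y \<noteq> x" "y \<in> perp F x"
          using that(3) collinearity_adj_iff[OF that(1,2)] perp_commute[OF that(1,2)] by auto
        then show ?thesis
          by (intro collinearity_adj_iff[OF that(2,1), THEN iffD2] conjI)
      qed
    qed
    show "irreflp_on points (collinearity_adj F)"
      by (rule irreflp_onI) (simp add: collinearity_adj_def)
    obtain x y where xy: "x \<in> points" "y \<in> points" "x \<noteq> y" "\<not> G.adj (\<lambda>H. H) x y"
      using witnesses(1)[OF blocks[OF W]] by blast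
    then show "\<exists>x\<in>points. \<exists>y\<in>points. x \<noteq> y \<and> \<not> collinearity_adj F x y"
      using adj_eq[OF W xy(1,2)] by blast
    obtain x y where xy: "x \<in> points" "y \<in> points" "G.adj (\<lambda>H. H) x y"
      using witnesses(2)[OF blocks[OF W]] by blast
    then show "\<exists>x\<in>points. \<exists>y\<in>points. collinearity_adj F x y"
      using adj_eq[OF W xy(1,2)] by blast
    show "finite points"
      by (rule finite_points)
  qed (simp_all add: deg0 common_adj0 common_nonadj0)
  moreover have "strongly_regular points (G.adj \<phi>) (card points) k0 l0 m0"
    unfolding strongly_regular_def
  proof (intro conjI)
    show "symp_on points (G.adj \<phi>)"
    proof (rule symp_onI)
      show "G.adj \<phi> y x" if "x \<in> points" "y \<in> points" "G.adj \<phi> x y" for x y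
        using that(3) perp_commute[OF that(1,2)] unfolding G.adj_def by blast
    qed
    have irrefl: "\<not> G.adj \<phi> x x" for x
      by (simp add: G.adj_def)
    then show "irreflp_on points (G.adj \<phi>)"
      by (rule irreflp_onI)
    show "\<forall>x\<in>points. \<forall>y\<in>points. G.adj \<phi> x y \<longrightarrow>
        card {z \<in> points. G.adj \<phi> x z \<and> G.adj \<phi> y z} = l0"
    proof (intro ballI impI)
      fix x y
      assume xy: "x \<in> points" "y \<in> points" "G.adj \<phi> x y"
      then have "x \<noteq> y"
        using irrefl by blast
      then show "card {z \<in> points. G.adj \<phi> x z \<and> G.adj \<phi> y z} = l0"
        using common xy by simp
    qed
    show "\<forall>x\<in>points. \<forall>y\<in>points. x \<noteq> y \<and> \<not> G.adj \<phi> x y \<longrightarrow>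
        card {z \<in> points. G.adj \<phi> x z \<and> G.adj \<phi> y z} = m0"
      by (simp add: common)
    show "finite points"
      by (rule finite_points)
    show "\<exists>x\<in>points. \<exists>y\<in>points. x \<noteq> y \<and> \<not> G.adj \<phi> x y"
      "\<exists>x\<in>points. \<exists>y\<in>points. G.adj \<phi> x y"
      by (rule witnesses[OF \<phi>_blocks])+
  qed (simp_all add: deg)
  moreover have "modified_adj F (proj_points W) \<phi> = G.adj \<phi>"
    by (intro ext) (rule modified_eq)
  ultimately show ?thesis
    by metis
qed

end

subsection \<open>Symplectic, quadratic and hermitian forms\<close>

lemma linear_functionalD:
  assumes "Vector_Spaces.linear scale (*) g"
  shows "g (u + v) = g u + g v" "g (scale a v) = a * g v"
proof -
  interpret Vector_Spaces.linear scale "(*)" g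
    by (rule assms)
  show "g (u + v) = g u + g v" "g (scale a v) = a * g v"
    by (rule add, rule scale)
qed

text \<open>All vectors are isotropic, so \<open>sing\<close> is constantly true. Reflexivity comes
  from expanding \<open>f (v + w) (v + w) = 0\<close>.\<close>

lemma formed_space_symplectic:
  fixes scale :: "'k::{field,finite} \<Rightarrow> 'v::ab_group_add \<Rightarrow> 'v"
  assumes V: "finite_dimensional_vector_space scale Basis"
    and nondeg: "vector_space.nondegenerate_form scale (Symplectic f)"
  shows "formed_space scale Basis (Symplectic f) f (\<lambda>_. True) CARD('k)"
proof -
  interpret finite_dimensional_vector_space scale Basis
    by (rule V)
  have lin: "Vector_Spaces.linear scale (*) (\<lambda>w. f v w)" "Vector_Spaces.linear scale (*) (\<lambda>v. f v w)"
    and alt: "f v v = 0" and rad: "(\<forall>w. f v w = 0) \<Longrightarrow> v = 0" for v w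
    using nondeg by (auto simp: bilinear_form_def)
  note left = linear_functionalD[OF lin(2)] and right = linear_functionalD[OF lin(1)]
  have "f (v + w) (v + w) = f v w + f w v" for v w
    unfolding left(1) right(1) by (simp add: alt)
  then have "f v w + f w v = 0" for v w
    using alt by simp
  then have reflexive: "f w v = 0" if "f v w = 0" for v w
    using that by (metis add_0)
  show ?thesis
    by unfold_locales (use left alt rad reflexive in auto)
qed

text \<open>The expansion of \<open>Q (v + w)\<close> by the polar form gives closure under
  orthogonal sums. It also makes \<open>Q (w + scale a x)\<close> affine in \<open>a\<close> for
  singular \<open>x\<close>, with slope \<open>polar_form Q x w\<close>, so a nonzero slope yields a
  root.\<close>

lemma formed_space_quadratic:
  fixes scale :: "'k::{field,finite} \<Rightarrow> 'v::ab_group_add \<Rightarrow> 'v"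
  assumes V: "finite_dimensional_vector_space scale Basis"
    and nondeg: "vector_space.nondegenerate_form scale (Quadratic Q)"
  shows "formed_space scale Basis (Quadratic Q) (polar_form Q) (\<lambda>v. Q v = 0) CARD('k)"
proof -
  interpret finite_dimensional_vector_space scale Basis
    by (rule V)
  have lin: "Vector_Spaces.linear scale (*) (\<lambda>w. polar_form Q v w)"
      "Vector_Spaces.linear scale (*) (\<lambda>v. polar_form Q v w)"
    and sq: "Q (scale a v) = a\<^sup>2 * Q v"
    and rad: "Q v = 0 \<and> (\<forall>w. polar_form Q v w = 0) \<Longrightarrow> v = 0" for a v w
    using nondeg by (auto simp: bilinear_form_def)
  note left = linear_functionalD[OF lin(2)] and right = linear_functionalD[OF lin(1)]
  have sum: "Q (v + w) = polar_form Q v w + Q v + Q w" for v w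
    by (simp add: polar_form_def)
  have sym: "polar_form Q w v = polar_form Q v w" for v w
    by (simp add: polar_form_def add.commute)
  have zero: "Q 0 = 0"
    using sq[of 0 0] by simp
  have self: "polar_form Q v v = 0" if "Q v = 0" for v
  proof -
    \<comment> \<open>Computing \<open>Q (v + v)\<close> by homogeneity works in every
      characteristic.\<close>
    have "v + v = scale (1 + 1) v"
      by (simp only: scale_left_distrib scale_one)
    then have "Q (v + v) = 0"
      using that sq[of "1 + 1" v] by simp
    then show ?thesis
      using that by (simp add: polar_form_def)
  qed
  have shift: "\<exists>a. Q (w + scale a x) = 0" if "Q x = 0" "polar_form Q x w \<noteq> 0" for x w
  proof
    show "Q (w + scale (- Q w / polar_form Q x w) x) = 0"
      unfolding sum right(2) sq sym[of w x] using that by simp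
  qed
  show ?thesis
  proof unfold_locales
    show "vanishes_on (Quadratic Q) T \<longleftrightarrow>
        (\<forall>v\<in>T. Q v = 0) \<and> (\<forall>v\<in>T. \<forall>w\<in>T. polar_form Q v w = 0)" if "subspace T" for T
      using subspace_add[OF that] by (auto simp: polar_form_def)
    show "\<exists>a. Q (w + scale a x) = 0" if "Q x = 0" "polar_form Q x w \<noteq> 0" for x w
      using shift that .
    show "Q (scale a v) = 0" if "Q v = 0" for a v
      using that by (simp add: sq)
    show "Q (v + w) = 0" if "Q v = 0" "Q w = 0" "polar_form Q v w = 0" for v w
      using that by (simp add: sum)
    show "polar_form Q w v = 0" if "polar_form Q v w = 0" for v w
      using that by (simp add: sym[of w v])
    show "polar_form Q v v = 0" if "Q v = 0" for v
      using self that .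
  qed (use left zero rad in auto)
qed

text \<open>The trace \<open>t + \<sigma> t\<close> is nonzero for some \<open>t\<close>; dividing
  by this trace, which is fixed by \<open>\<sigma>\<close>, gives an element of trace
  \<open>1\<close>. Its multiple by \<open>- c\<close> is the required \<open>b\<close>, as
  \<open>c\<close> is fixed too.\<close>

lemma involution_trace_surj:
  assumes "field_involution \<sigma>" "\<sigma> c = c"
  obtains b where "c + b + \<sigma> b = 0"
proof -
  have \<sigma>: "\<sigma> (a + b) = \<sigma> a + \<sigma> b" "\<sigma> (a * b) = \<sigma> a * \<sigma> b" "\<sigma> (\<sigma> a) = a" "\<sigma> \<noteq> id" for a b
    using assms by (auto simp: field_involution_def)
  have \<sigma>0: "\<sigma> 0 = 0"
    using \<sigma>(1)[of 0 0] by (simp only: add_0_left add_cancel_right_right)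
  have \<sigma>_minus: "\<sigma> (- a) = - \<sigma> a" for a
    using \<sigma>(1)[of a "- a"] \<sigma>0 by (simp add: eq_neg_iff_add_eq_0 add.commute)
  have "\<sigma> 1 \<noteq> 0"
    using \<sigma>(3)[of 1] \<sigma>0 by auto
  then have \<sigma>1: "\<sigma> 1 = 1"
    using \<sigma>(2)[of 1 1] by simp
  have "\<exists>t. t + \<sigma> t \<noteq> 0"
  proof (rule ccontr)
    assume "\<nexists>t. t + \<sigma> t \<noteq> 0"
    then have t: "t + \<sigma> t = 0" for t
      by blast
    \<comment> \<open>A vanishing trace would give characteristic 2 at \<open>t = 1\<close>, and
      then \<open>\<sigma> t = t\<close> for all \<open>t\<close>, against
      \<open>\<sigma> \<noteq> id\<close>.\<close>
    have two: "1 + 1 = (0 :: 'a)"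
      using t[of 1] unfolding \<sigma>1 .
    have "\<sigma> t = t" for t
    proof -
      have "t + t = (1 + 1) * t"
        by (simp only: distrib_right mult_1)
      then have "t + \<sigma> t = t + t"
        unfolding two t by (simp only: mult_zero_left)
      then show ?thesis
        by (simp only: add_left_cancel)
    qed
    then show False
      using \<sigma>(4) by auto
  qed
  then obtain t where t: "t + \<sigma> t \<noteq> 0"
    by blast
  define s where "s = t + \<sigma> t"
  define e where "e = inverse s"
  have se: "s * e = 1"
    using t by (simp add: e_def s_def)
  have "\<sigma> s = s"
    by (simp add: s_def \<sigma> add.commute)
  then have "s * \<sigma> e = 1"
    using \<sigma>(2)[of s e] se \<sigma>1 by simp
  then have "s * \<sigma> e = s * e"
    using se by (simp only:)
  then have \<sigma>e: "\<sigma> e = e"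
    using t by (simp add: s_def)
  have "c + (- (c * e * t)) + \<sigma> (- (c * e * t)) = c - c * e * s"
    by (simp add: \<sigma>_minus \<sigma>(2) assms(2) \<sigma>e s_def algebra_simps)
  also have "\<dots> = c - c * (s * e)"
    by (simp only: mult.assoc mult.commute[of e s])
  also have "\<dots> = 0"
    unfolding se by simp
  finally show ?thesis
    using that by blast
qed

text \<open>For the shift by an isotropic \<open>x\<close>, the value of the form at
  \<open>w + scale a x\<close> is \<open>h w w + b + \<sigma> b\<close> with
  \<open>b = a * h x w\<close>. As \<open>h w w\<close> is fixed by \<open>\<sigma>\<close>,
  \<open>involution_trace_surj\<close> gives a suitable \<open>b\<close>, and \<open>a\<close> is
  found by division by \<open>h x w\<close>.\<close>

lemma formed_space_hermitian:
  fixes scale :: "'k::{field,finite} \<Rightarrow> 'v::ab_group_add \<Rightarrow> 'v"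
  assumes V: "finite_dimensional_vector_space scale Basis"
    and nondeg: "vector_space.nondegenerate_form scale (Hermitian \<sigma> h)"
  shows "formed_space scale Basis (Hermitian \<sigma> h) h (\<lambda>v. h v v = 0) CARD('k)"
proof -
  interpret finite_dimensional_vector_space scale Basis
    by (rule V)
  have inv: "field_involution \<sigma>"
    and lin: "Vector_Spaces.linear scale (*) (\<lambda>v. h v w)"
    and herm: "h w v = \<sigma> (h v w)" and rad: "(\<forall>w. h v w = 0) \<Longrightarrow> v = 0" for v w
    using nondeg unfolding nondegenerate_form.simps by blast+
  note left = linear_functionalD[OF lin]
  have \<sigma>: "\<sigma> (a + b) = \<sigma> a + \<sigma> b" for a b
    using inv by (auto simp: field_involution_def)
  have \<sigma>0: "\<sigma> 0 = 0"
    using \<sigma>[of 0 0] by (simp only: add_0_left add_cancel_right_right)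
  have reflexive: "h w v = 0" if "h v w = 0" for v w
    using herm[of w v] that \<sigma>0 by simp
  have right_add: "h v (u + w) = h v u + h v w" for u v w
    using herm[of v "u + w"] herm[of v u] herm[of v w] by (simp add: left \<sigma>)
  have right_scale: "h v (scale a w) = \<sigma> (a * h w v)" for a v w
    using herm[of v "scale a w"] by (simp add: left)
  have zero: "h 0 w = 0" for w
    using left(2)[of 0 0 w] by simp
  have shift: "\<exists>a. h (w + scale a x) (w + scale a x) = 0" if x: "h x x = 0" "h x w \<noteq> 0" for x w
  proof -
    obtain b where b: "h w w + b + \<sigma> b = 0"
      by (rule involution_trace_surj[OF inv herm[symmetric]])
    define a where "a = b / h x w"
    have "a * h x w = b"
      using x by (simp add: a_def)
    then have "h (w + scale a x) (w + scale a x) = h w w + b + \<sigma> b"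
      by (simp add: left right_add right_scale x \<sigma>0 algebra_simps)
    then show ?thesis
      using b by auto
  qed
  show ?thesis
  proof unfold_locales
    show "h (scale a v) (scale a v) = 0" if "h v v = 0" for a v
      using that by (simp add: left right_scale \<sigma>0)
    show "h (v + w) (v + w) = 0" if "h v v = 0" "h w w = 0" "h v w = 0" for v w
      using that reflexive[of v w] by (simp add: left right_add)
    show "\<exists>a. h (w + scale a x) (w + scale a x) = 0" if "h x x = 0" "h x w \<noteq> 0" for x w
      using shift that .
    show "vanishes_on (Hermitian \<sigma> h) T \<longleftrightarrow>
        (\<forall>v\<in>T. h v v = 0) \<and> (\<forall>v\<in>T. \<forall>w\<in>T. h v w = 0)" if "subspace T" for T
      by auto
    show "h w v = 0" if "h v w = 0" for v w
      using reflexive that .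
  qed (use left zero rad in auto)
qed

lemma formed_space_exists:
  fixes scale :: "'k::{field,finite} \<Rightarrow> 'v::ab_group_add \<Rightarrow> 'v"
  assumes "finite_dimensional_vector_space scale Basis" "vector_space.nondegenerate_form scale F"
  shows "\<exists>f sing. formed_space scale Basis F f sing CARD('k)"
  using assms formed_space_symplectic formed_space_quadratic formed_space_hermitian
  by (cases F) blast+

theorem theorem7p1:
  fixes scale :: "'k::{field,finite} \<Rightarrow> 'v::ab_group_add \<Rightarrow> 'v"
    and Basis :: "'v set"
    and F :: "('k, 'v) form"
    and q d :: nat
    and W :: "'v set" and U :: "'v set set"
    and \<B> :: "'v set set set"
    and \<phi> :: "'v set set \<Rightarrow> 'v set set"
  assumes "finite_dimensional_vector_space scale Basis"
    and "q = CARD('k)"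
    and "vector_space.nondegenerate_form scale F"
    and "vector_space.has_rank scale F d"
    and "d \<ge> 3"
    and "vector_space.totally_isotropic scale F W"
    and "vector_space.dim scale W = d"
    and "U = vector_space.proj_points scale W"
    and "symmetric_design U \<B> ((q ^ d - 1) div (q - 1)) ((q ^ (d - 1) - 1) div (q - 1))
           ((q ^ (d - 2) - 1) div (q - 1))"
    and "bij_betw \<phi> (vector_space.hyperplanes scale W) \<B>"
  shows "\<exists>v k l m.
    strongly_regular (vector_space.polar_points scale F)
      (vector_space.collinearity_adj scale F) v k l m \<and>
    strongly_regular (vector_space.polar_points scale F)
      (vector_space.modified_adj scale F U \<phi>) v k l m"
proof -
  obtain f sing where "formed_space scale Basis F f sing q"
    using formed_space_exists[OF assms(1,3)] assms(2) by blast
  then have "polar_space scale Basis F f sing q d"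
    using assms(4,5) by (simp add: polar_space_def polar_space_axioms_def)
  then interpret polar_space scale Basis F f sing q d .
  have "generator W"
    using assms(6,7) by (simp add: generator_def)
  then show ?thesis
    using strongly_regular_modification[of W \<B> \<phi>] assms(9,10) unfolding assms(8) theta_def by blast
qed

end
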